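(* Let $X$ be a separable Banach space and let $\mathcal{T}=\{T_t\}_{t\in\Delta}$ be a $C_0$-semigroup on $X$ indexed by a complex sector $\Delta$. If $\mathrm{DAsym}(\mathcal{T},\mathbf{0})$ is dense in $X$, then $\mathcal{T}$ is distributionally sensitive if and only if $\mathcal{T}$ has a dense distributionally irregular manifold.
   Context: Banach spaces are assumed nonzero. A complex sector is $\Delta=\Delta(\alpha)=\{re^{i\theta}\in\mathbb{C}: r\ge 0,\ |\theta|\le\alpha\}$ for some $\alpha\in(0,\pi/2)$; it is a semigroup under addition. For $r>0$ put $\Delta_r=\{t\in\Delta:|t|<r\}$. With $\mu$ the (planar) Lebesgue measure, for measurable $A\subset\Delta$ the upper density is $\overline{\mathrm{dens}}(A)=\limsup_{r\to\infty}\mu(A\cap\Delta_r)/\mu(\Delta_r)$, the lower density $\underline{\mathrm{dens}}(A)$ is the corresponding $\liminf$, and if they agree the common value is the density $\mathrm{dens}(A)$. A family $\{T_t\}_{t\in\Delta}$ of continuous linear operators on a Banach space $X$ is a $C_0$-semigroup if $T_0=I$, $T_tT_s=T_{t+s}$ for all $t,s\in\Delta$, and $\lim_{t\to s}T_tx=T_sx$ in norm for all $s\in\Delta$, $x\in X$. For the zero vector $\mathbf{0}\in X$, $\mathrm{DAsym}(\mathcal{T},\mathbf{0})$ is the set of $y\in X$ such that $\mathrm{dens}(\{t\in\Delta:\|T_ty\|<\varepsilon\})=1$ for every $\varepsilon>0$. $\mathcal{T}$ is distributionally sensitive if there is $\delta>0$ such that for every $x\in X$ and $\varepsilon>0$ there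 is $y\in X$ with $\|x-y\|<\varepsilon$ and $\overline{\mathrm{dens}}(\{t\in\Delta:\|T_tx-T_ty\|>\delta\})=1$. A vector $x\in X$ is distributionally irregular if there are measurable $A,B\subset\Delta$ with $\overline{\mathrm{dens}}(A)=\overline{\mathrm{dens}}(B)=1$ such that $\lim_{t\in A,\,|t|\to\infty}\|T_tx\|=0$ and $\lim_{t\in B,\,|t|\to\infty}\|T_tx\|=\infty$. A distributionally irregular manifold is a vector subspace $Y$ of $X$ such that every $y\in Y\setminus\{\mathbf{0}\}$ is distributionally irregular for $\mathcal{T}$. *)

theory Defs
  imports "HOL-Analysis.Analysis"
begin

text \<open>
  Scalars: a Banach space is a type of class \<open>banach\<close> together with a scalar multiplication by a
  field \<open>'k\<close> of class \<open>real_normed_field\<close> and \<open>euclidean_space\<close>, i.e. real or complex scalars.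
  This treats real and complex Banach spaces at once; for \<open>'k = real\<close> the scalar multiplication
  is necessarily \<open>scaleR\<close>.
\<close>

locale normed_space_over = vector_space smul
  for smul :: "'k::real_normed_field \<Rightarrow> 'a::real_normed_vector \<Rightarrow> 'a" +
  assumes norm_smul: "norm (smul c x) = norm c * norm x"
    and smul_of_real: "smul (of_real r) x = r *\<^sub>R x"

definition sector :: "real \<Rightarrow> complex set" where
  "sector \<alpha> = {rcis r \<theta> | r \<theta>. 0 \<le> r \<and> \<bar>\<theta>\<bar> \<le> \<alpha>}"

definition sector_trunc :: "real \<Rightarrow> real \<Rightarrow> complex set" where
  "sector_trunc \<alpha> r = {t \<in> sector \<alpha>. norm t < r}"

text \<open>
  The densities are meant for Lebesgue measurable subsets of the sector. They take values in
  \<open>ereal\<close> because \<open>Limsup\<close> and \<open>Liminf\<close> require a complete lattice.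
\<close>

definition upper_dens :: "real \<Rightarrow> complex set \<Rightarrow> ereal" where
  "upper_dens \<alpha> A = Limsup at_top
     (\<lambda>r. ereal (measure lebesgue (A \<inter> sector_trunc \<alpha> r) / measure lebesgue (sector_trunc \<alpha> r)))"

definition lower_dens :: "real \<Rightarrow> complex set \<Rightarrow> ereal" where
  "lower_dens \<alpha> A = Liminf at_top
     (\<lambda>r. ereal (measure lebesgue (A \<inter> sector_trunc \<alpha> r) / measure lebesgue (sector_trunc \<alpha> r)))"

definition has_dens :: "real \<Rightarrow> complex set \<Rightarrow> ereal \<Rightarrow> bool" where
  "has_dens \<alpha> A d \<longleftrightarrow> upper_dens \<alpha> A = d \<and> lower_dens \<alpha> A = d"

text \<open>
  A family indexed by the sector is a function on all of \<open>complex\<close>; its values outside the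
  sector are never used.
\<close>

definition C0_semigroup ::
  "('k::real_normed_field \<Rightarrow> 'a::real_normed_vector \<Rightarrow> 'a) \<Rightarrow> real \<Rightarrow> (complex \<Rightarrow> 'a \<Rightarrow> 'a) \<Rightarrow> bool"
  where
  "C0_semigroup smul \<alpha> T \<longleftrightarrow>
     (\<forall>t\<in>sector \<alpha>. Vector_Spaces.linear smul smul (T t) \<and> continuous_on UNIV (T t)) \<and>
     T 0 = id \<and>
     (\<forall>t\<in>sector \<alpha>. \<forall>s\<in>sector \<alpha>. T t \<circ> T s = T (t + s)) \<and>
     (\<forall>s\<in>sector \<alpha>. \<forall>x. ((\<lambda>t. T t x) \<longlongrightarrow> T s x) (at s within sector \<alpha>))"

definition DAsym0 :: "real \<Rightarrow> (complex \<Rightarrow> 'a::real_normed_vector \<Rightarrow> 'a) \<Rightarrow> 'a set" where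
  "DAsym0 \<alpha> T = {y. \<forall>\<epsilon>>0. has_dens \<alpha> {t \<in> sector \<alpha>. norm (T t y) < \<epsilon>} 1}"

definition distributionally_sensitive ::
  "real \<Rightarrow> (complex \<Rightarrow> 'a::real_normed_vector \<Rightarrow> 'a) \<Rightarrow> bool" where
  "distributionally_sensitive \<alpha> T \<longleftrightarrow>
     (\<exists>\<delta>>0. \<forall>x. \<forall>\<epsilon>>0. \<exists>y. norm (x - y) < \<epsilon> \<and>
        upper_dens \<alpha> {t \<in> sector \<alpha>. norm (T t x - T t y) > \<delta>} = 1)"

definition distributionally_irregular ::
  "real \<Rightarrow> (complex \<Rightarrow> 'a::real_normed_vector \<Rightarrow> 'a) \<Rightarrow> 'a \<Rightarrow> bool" where
  "distributionally_irregular \<alpha> T x \<longleftrightarrow>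
     (\<exists>A B. A \<in> sets lebesgue \<and> B \<in> sets lebesgue \<and> A \<subseteq> sector \<alpha> \<and> B \<subseteq> sector \<alpha> \<and>
        upper_dens \<alpha> A = 1 \<and> upper_dens \<alpha> B = 1 \<and>
        ((\<lambda>t. norm (T t x)) \<longlongrightarrow> 0) (inf at_infinity (principal A)) \<and>
        filterlim (\<lambda>t. norm (T t x)) at_top (inf at_infinity (principal B)))"

definition distributionally_irregular_manifold ::
  "('k::real_normed_field \<Rightarrow> 'a::real_normed_vector \<Rightarrow> 'a) \<Rightarrow> real \<Rightarrow> (complex \<Rightarrow> 'a \<Rightarrow> 'a) \<Rightarrow>
   'a set \<Rightarrow> bool" where
  "distributionally_irregular_manifold smul \<alpha> T Y \<longleftrightarrow>
     module.subspace smul Y \<and> (\<forall>y\<in>Y - {0}. distributionally_irregular \<alpha> T y)"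

end

theory Submission
  imports Defs
begin

text \<open>
  Sensitivity is inherited from one irregular vector \<open>z\<close>: perturb \<open>x\<close> by a small multiple of \<open>z\<close>.

  Conversely, sensitivity at \<open>0\<close> gives arbitrarily small vectors with large orbit on most of some
  large truncated sector, and by local boundedness of the semigroup these may be taken in the dense
  subspace \<open>D = DAsym0\<close>. A gliding hump construction yields \<open>u k \<in> D\<close> and radii
  \<open>s k \<longrightarrow> \<infinity>\<close> such that, on most of the sector truncated at \<open>s k\<close>, the orbit of \<open>u k\<close> is huge while
  those of all other \<open>u j\<close> together are tiny. Hence \<open>\<Sum>k. \<gamma> k u k\<close> is irregular whenever the bounded
  coefficients \<open>\<gamma> k\<close> vanish infinitely often and are bounded away from \<open>0\<close> infinitely often, and adding
  an element of \<open>D\<close> does not change this. Let \<open>x i\<close> be the sum of the \<open>u k\<close> over the \<open>i\<close>-th of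
  infinitely many disjoint infinite blocks of indices and let \<open>d i \<in> D\<close> visit every ball infinitely
  often; the span of the vectors \<open>d i + \<eta> i x i\<close>, with small \<open>\<eta> i > 0\<close>, is dense, and every nontrivial
  combination of them is of the form just described.
\<close>

subsection \<open>Densities in a sector\<close>

text \<open>The counterpart for \<open>Limsup\<close> of \<open>le_Liminf_iff\<close>, with
  frequently in place of eventually. If \<open>Limsup F f\<close> lay below \<open>C\<close>,
  density of the order would give a level strictly between them that \<open>f\<close> eventually
  does not exceed.\<close>

lemma le_Limsup_iff_frequently:
  fixes f :: "'b \<Rightarrow> 'c :: {complete_linorder, dense_linorder}"
  shows "C \<le> Limsup F f \<longleftrightarrow> (\<forall>y<C. \<exists>\<^sub>F x in F. y < f x)"
proof (intro iffI allI impI)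
  fix y assume "C \<le> Limsup F f" "y < C"
  show "\<exists>\<^sub>F x in F. y < f x"
  proof (rule ccontr)
    assume "\<not> (\<exists>\<^sub>F x in F. y < f x)"
    then have "Limsup F f \<le> y" by (intro Limsup_bounded) (simp add: not_frequently not_less)
    with \<open>C \<le> Limsup F f\<close> \<open>y < C\<close> show False by simp
  qed
next
  assume *: "\<forall>y<C. \<exists>\<^sub>F x in F. y < f x"
  show "C \<le> Limsup F f"
  proof (rule ccontr)
    assume "\<not> C \<le> Limsup F f"
    then obtain y where y: "Limsup F f < y" "y < C" using dense[of "Limsup F f" C] by (auto simp: not_le)
    then have "\<forall>\<^sub>F x in F. \<not> y < f x" by (auto dest!: Limsup_lessD elim: eventually_mono)
    with * y show False by (simp add: frequently_def)
  qed
qed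

text \<open>Levels in \<open>ereal\<close>, including minus infinity, are traded for real errors
  \<epsilon>: as \<open>P\<close> is inherited by smaller levels, it suffices to find a real number
  between \<open>y\<close> and 1.\<close>

lemma all_less_1_ereal_iff:
  fixes P :: "ereal \<Rightarrow> bool"
  assumes "\<And>x y. x \<le> y \<Longrightarrow> P y \<Longrightarrow> P x"
  shows "(\<forall>y<1. P y) \<longleftrightarrow> (\<forall>\<epsilon>>0. P (ereal (1 - \<epsilon>)))"
proof safe
  fix y :: ereal assume *: "\<forall>\<epsilon>>0. P (ereal (1 - \<epsilon>))" "y < 1"
  obtain z where "y < ereal z" "ereal z < 1" using ereal_dense2[OF *(2)] by auto
  then show "P y" using *(1)[rule_format, of "1 - z"] assms[of y "ereal z"] by simp
qed (simp add: one_ereal_def)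

section \<open>Geometry and area of truncated sectors\<close>

text \<open>For angles below pi/2 the cosine is positive, so the bound on the angle is a bound on
  the slope Im/Re. In this form the sector is visibly closed and membership of boxes is easy to
  test.\<close>

lemma sector_eq:
  assumes "0 < \<alpha>" "\<alpha> < pi / 2"
  shows "sector \<alpha> = {z. 0 \<le> Re z \<and> \<bar>Im z\<bar> \<le> tan \<alpha> * Re z}"
proof (intro equalityI subsetI)
  fix z assume "z \<in> sector \<alpha>"
  then obtain r \<theta> where z: "z = rcis r \<theta>" "0 \<le> r" "\<bar>\<theta>\<bar> \<le> \<alpha>"
    by (auto simp: sector_def)
  have c: "cos \<theta> > 0"
    using z assms by (intro cos_gt_zero_pi) auto
  have "\<bar>tan \<theta>\<bar> \<le> tan \<alpha>"
    using z(3) assms tan_mono_le[of \<theta> \<alpha>] tan_mono_le[of "-\<theta>" \<alpha>] by (auto simp: abs_le_iff)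
  then have "\<bar>sin \<theta>\<bar> \<le> tan \<alpha> * cos \<theta>"
    using c by (simp add: tan_def field_simps)
  then have "r * \<bar>sin \<theta>\<bar> \<le> r * (tan \<alpha> * cos \<theta>)"
    using z(2) by (rule mult_left_mono)
  then show "z \<in> {z. 0 \<le> Re z \<and> \<bar>Im z\<bar> \<le> tan \<alpha> * Re z}"
    using z c by (simp add: abs_mult mult_ac)
next
  fix z assume "z \<in> {z. 0 \<le> Re z \<and> \<bar>Im z\<bar> \<le> tan \<alpha> * Re z}"
  then have z: "0 \<le> Re z" "\<bar>Im z\<bar> \<le> tan \<alpha> * Re z" by auto
  define \<theta> where "\<theta> = arctan (Im z / Re z)"
  have c: "cos \<theta> > 0"
    unfolding \<theta>_def using arctan_lbound arctan_ubound by (intro cos_gt_zero_pi) auto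
  show "z \<in> sector \<alpha>"
  proof (cases "Re z = 0")
    \<comment> \<open>The slope is undefined here, but the inequality then forces
      \<open>z = 0\<close>.\<close>
    case True
    then have "z = rcis 0 0" using z by (simp add: complex_eq_iff)
    then show ?thesis
      using assms unfolding sector_def by (intro CollectI exI[of _ 0] conjI) auto
  next
    case False
    then have pos: "Re z > 0" using z by simp
    have "Im z / Re z \<le> tan \<alpha>" "- tan \<alpha> \<le> Im z / Re z"
      using z pos by (auto simp: field_simps abs_le_iff)
    then have "\<theta> \<le> arctan (tan \<alpha>)" "arctan (- tan \<alpha>) \<le> \<theta>"
      unfolding \<theta>_def arctan_le_iff by auto
    moreover have "arctan (tan \<alpha>) = \<alpha>" using assms by (intro arctan_tan) auto
    ultimately have "\<bar>\<theta>\<bar> \<le> \<alpha>" by (simp add: arctan_minus)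
    moreover have "sin \<theta> = cos \<theta> * (Im z / Re z)"
      using c tan_arctan[of "Im z / Re z"] unfolding \<theta>_def tan_def by (simp add: field_simps)
    then have "z = rcis (Re z / cos \<theta>) \<theta>"
      using c pos by (simp add: complex_eq_iff)
    ultimately show ?thesis
      using c pos unfolding sector_def by (intro CollectI exI conjI) auto
  qed
qed

locale sector_angle =
  fixes \<alpha> :: real
  assumes angle: "0 < \<alpha>" "\<alpha> < pi / 2"
begin

lemma closed_sector: "closed (sector \<alpha>)"
  unfolding sector_eq[OF angle]
  by (intro closed_Collect_conj closed_Collect_le continuous_intros)

lemma sector_trunc_eq: "sector_trunc \<alpha> r = sector \<alpha> \<inter> ball 0 r"
  by (auto simp: sector_trunc_def)

lemma sector_trunc_lmeasurable [simp]: "sector_trunc \<alpha> r \<in> lmeasurable"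
  unfolding sector_trunc_eq using closed_sector
  by (intro bounded_set_imp_lmeasurable) (auto intro: bounded_Int)

lemma sector_trunc_sets [measurable, simp]: "sector_trunc \<alpha> r \<in> sets lebesgue"
  using sector_trunc_lmeasurable by (rule fmeasurableD)

text \<open>The truncated sector contains a box whose side lengths are proportional to
  \<open>r\<close>, so its area grows at least quadratically.\<close>

lemma measure_sector_trunc_at_top:
  "filterlim (\<lambda>r. measure lebesgue (sector_trunc \<alpha> r)) at_top at_top"
proof -
  define c where "c = tan \<alpha>"
  have c: "c > 0" unfolding c_def using angle by (intro tan_gt_zero) auto
  \<comment> \<open>With \<open>b = a r\<close>, points of the box have norm at most
    \<open>(2 + c) * b\<close>, which this choice makes equal to \<open>r / 2\<close>.\<close>
  define a where "a r = inverse (2 * (2 + c)) * r" for r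
  have "filterlim (\<lambda>r. 2 * c * (a r)\<^sup>2) at_top at_top"
    unfolding a_def using c
    by (intro filterlim_tendsto_pos_mult_at_top[OF tendsto_const] filterlim_pow_at_top filterlim_ident) auto
  moreover have "\<forall>\<^sub>F r in at_top. 2 * c * (a r)\<^sup>2 \<le> measure lebesgue (sector_trunc \<alpha> r)"
    using eventually_gt_at_top[of 0]
  proof eventually_elim
    case (elim r)
    define b where "b = a r"
    have b: "b > 0" "(2 + c) * b < r" using elim c by (auto simp: a_def b_def field_simps intro: add_pos_pos)
    let ?B = "cbox (Complex b (- (c * b))) (Complex (2 * b) (c * b))"
    have "?B \<subseteq> sector_trunc \<alpha> r"
    proof
      fix z assume "z \<in> ?B"
      then have z: "b \<le> Re z" "Re z \<le> 2 * b" "\<bar>Im z\<bar> \<le> c * b"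
        by (auto simp: in_cbox_complex_iff)
      have "c * b \<le> c * Re z" using c z by simp
      then have "z \<in> sector \<alpha>"
        unfolding sector_eq[OF angle] c_def[symmetric] using z b by auto
      moreover have "norm z \<le> 2 * b + c * b"
        using cmod_le[of z] z b by auto
      ultimately show "z \<in> sector_trunc \<alpha> r"
        using b by (simp add: sector_trunc_def algebra_simps)
    qed
    then have "measure lebesgue ?B \<le> measure lebesgue (sector_trunc \<alpha> r)"
      by (intro measure_mono_fmeasurable) auto
    also have "measure lebesgue ?B = 2 * c * b\<^sup>2"
      using b c by (simp add: measure_lborel_cbox_eq Basis_complex_def inner_complex_def power2_eq_square)
    finally show ?case by (simp add: b_def)
  qed
  ultimately show ?thesis by (rule filterlim_at_top_mono)
qed

lemma eventually_measure_sector_trunc_pos: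
  "\<forall>\<^sub>F r in at_top. 0 < measure lebesgue (sector_trunc \<alpha> r)"
  using measure_sector_trunc_at_top by (auto simp: filterlim_at_top_dense)

section \<open>Full density in terms of the missing part of the truncated sector\<close>

lemma measure_sector_trunc_Diff:
  assumes "A \<in> sets lebesgue"
  shows "measure lebesgue (sector_trunc \<alpha> r - A) =
    measure lebesgue (sector_trunc \<alpha> r) - measure lebesgue (A \<inter> sector_trunc \<alpha> r)"
proof -
  have "sector_trunc \<alpha> r - A = sector_trunc \<alpha> r - A \<inter> sector_trunc \<alpha> r" by auto
  then show ?thesis
    using assms fmeasurable_Int_fmeasurable[OF sector_trunc_lmeasurable[of r] assms]
    by (simp add: measurable_measure_Diff Int_commute fmeasurableD)
qed

text \<open>Quotients are traded for the measure of the part that \<open>A\<close> misses: these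
  missing measures add up when sets are intersected, which makes density estimates simple.\<close>

lemma sector_trunc_fraction_gt_iff:
  assumes "A \<in> sets lebesgue" "0 < measure lebesgue (sector_trunc \<alpha> r)"
  shows "1 - \<epsilon> < measure lebesgue (A \<inter> sector_trunc \<alpha> r) / measure lebesgue (sector_trunc \<alpha> r) \<longleftrightarrow>
    measure lebesgue (sector_trunc \<alpha> r - A) < \<epsilon> * measure lebesgue (sector_trunc \<alpha> r)"
  using assms by (simp add: measure_sector_trunc_Diff field_simps)

lemma upper_dens_le_1: "A \<in> sets lebesgue \<Longrightarrow> upper_dens \<alpha> A \<le> 1"
  unfolding upper_dens_def
proof (rule Limsup_bounded)
  assume A: "A \<in> sets lebesgue"
  show "\<forall>\<^sub>F r in at_top. ereal (measure lebesgue (A \<inter> sector_trunc \<alpha> r) /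
          measure lebesgue (sector_trunc \<alpha> r)) \<le> 1"
    using eventually_measure_sector_trunc_pos
  proof eventually_elim
    case (elim r)
    have "measure lebesgue (A \<inter> sector_trunc \<alpha> r) \<le> measure lebesgue (sector_trunc \<alpha> r)"
      using A by (intro measure_mono_fmeasurable) auto
    then show ?case using elim by simp
  qed
qed

lemma upper_dens_eq_1_iff:
  assumes "A \<in> sets lebesgue"
  shows "upper_dens \<alpha> A = 1 \<longleftrightarrow> (\<forall>\<epsilon>>0. \<exists>\<^sub>F r in at_top.
    measure lebesgue (sector_trunc \<alpha> r - A) < \<epsilon> * measure lebesgue (sector_trunc \<alpha> r))"
proof -
  let ?f = "\<lambda>r. measure lebesgue (A \<inter> sector_trunc \<alpha> r) / measure lebesgue (sector_trunc \<alpha> r)"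
  have "upper_dens \<alpha> A = 1 \<longleftrightarrow> 1 \<le> upper_dens \<alpha> A"
    using upper_dens_le_1[OF assms] by auto
  also have "\<dots> \<longleftrightarrow> (\<forall>y<1. \<exists>\<^sub>F r in at_top. y < ereal (?f r))"
    unfolding upper_dens_def le_Limsup_iff_frequently ..
  also have "\<dots> \<longleftrightarrow> (\<forall>\<epsilon>>0. \<exists>\<^sub>F r in at_top. 1 - \<epsilon> < ?f r)"
    by (subst all_less_1_ereal_iff) (auto elim: frequently_elim1)
  also have "\<dots> \<longleftrightarrow> (\<forall>\<epsilon>>0. \<exists>\<^sub>F r in at_top.
    measure lebesgue (sector_trunc \<alpha> r - A) < \<epsilon> * measure lebesgue (sector_trunc \<alpha> r))"
    by (intro all_cong frequently_cong[OF eventually_measure_sector_trunc_pos]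
        sector_trunc_fraction_gt_iff assms)
  finally show ?thesis .
qed

text \<open>Only \<open>1 \<le> lower_dens \<alpha> A\<close> has content, because the lower density
  is at most the upper one and that is at most 1.\<close>

lemma has_dens_1_iff:
  assumes "A \<in> sets lebesgue"
  shows "has_dens \<alpha> A 1 \<longleftrightarrow> (\<forall>\<epsilon>>0. \<forall>\<^sub>F r in at_top.
    measure lebesgue (sector_trunc \<alpha> r - A) < \<epsilon> * measure lebesgue (sector_trunc \<alpha> r))"
proof -
  let ?f = "\<lambda>r. measure lebesgue (A \<inter> sector_trunc \<alpha> r) / measure lebesgue (sector_trunc \<alpha> r)"
  have "lower_dens \<alpha> A \<le> upper_dens \<alpha> A"
    unfolding lower_dens_def upper_dens_def by (intro Liminf_le_Limsup) simp
  then have "has_dens \<alpha> A 1 \<longleftrightarrow> 1 \<le> lower_dens \<alpha> A"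
    using upper_dens_le_1[OF assms] unfolding has_dens_def by auto
  also have "\<dots> \<longleftrightarrow> (\<forall>y<1. \<forall>\<^sub>F r in at_top. y < ereal (?f r))"
    unfolding lower_dens_def le_Liminf_iff ..
  also have "\<dots> \<longleftrightarrow> (\<forall>\<epsilon>>0. \<forall>\<^sub>F r in at_top. 1 - \<epsilon> < ?f r)"
    by (subst all_less_1_ereal_iff) (auto elim: eventually_mono)
  also have "\<dots> \<longleftrightarrow> (\<forall>\<epsilon>>0. \<forall>\<^sub>F r in at_top.
    measure lebesgue (sector_trunc \<alpha> r - A) < \<epsilon> * measure lebesgue (sector_trunc \<alpha> r))"
    by (intro all_cong eventually_cong[OF eventually_measure_sector_trunc_pos]
        sector_trunc_fraction_gt_iff assms)
  finally show ?thesis .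
qed

lemma measure_sector_trunc_Diff_mono:
  assumes "A \<in> sets lebesgue" "sector_trunc \<alpha> r \<inter> A \<subseteq> B" "B \<in> sets lebesgue"
  shows "measure lebesgue (sector_trunc \<alpha> r - B) \<le> measure lebesgue (sector_trunc \<alpha> r - A)"
  using assms by (intro measure_mono_fmeasurable) (auto intro!: fmeasurable_Diff)

lemma measure_sector_trunc_Diff_Int_le:
  assumes "A \<in> sets lebesgue" "B \<in> sets lebesgue"
  shows "measure lebesgue (sector_trunc \<alpha> r - A \<inter> B) \<le>
    measure lebesgue (sector_trunc \<alpha> r - A) + measure lebesgue (sector_trunc \<alpha> r - B)"
  unfolding Diff_Int using assms
  by (intro measure_Un_le) auto

lemma upper_dens_1_mono:
  assumes "upper_dens \<alpha> A = 1" "A \<in> sets lebesgue" "B \<in> sets lebesgue" "A \<inter> sector \<alpha> \<subseteq> B"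
  shows "upper_dens \<alpha> B = 1"
proof -
  have *: "measure lebesgue (sector_trunc \<alpha> r - B) \<le> measure lebesgue (sector_trunc \<alpha> r - A)" for r
    using assms by (intro measure_sector_trunc_Diff_mono) (auto simp: sector_trunc_def)
  show ?thesis
    using assms(1) unfolding upper_dens_eq_1_iff[OF assms(2)] upper_dens_eq_1_iff[OF assms(3)]
    by (auto elim!: frequently_elim1 intro: le_less_trans[OF *])
qed

lemma has_dens_1_mono:
  assumes "has_dens \<alpha> A 1" "A \<in> sets lebesgue" "B \<in> sets lebesgue" "A \<inter> sector \<alpha> \<subseteq> B"
  shows "has_dens \<alpha> B 1"
proof -
  have *: "measure lebesgue (sector_trunc \<alpha> r - B) \<le> measure lebesgue (sector_trunc \<alpha> r - A)" for r
    using assms by (intro measure_sector_trunc_Diff_mono) (auto simp: sector_trunc_def)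
  show ?thesis
    using assms(1) unfolding has_dens_1_iff[OF assms(2)] has_dens_1_iff[OF assms(3)]
    by (auto elim!: eventually_mono intro: le_less_trans[OF *])
qed

lemma has_dens_1_Int:
  assumes "has_dens \<alpha> A 1" "has_dens \<alpha> B 1" "A \<in> sets lebesgue" "B \<in> sets lebesgue"
  shows "has_dens \<alpha> (A \<inter> B) 1"
  unfolding has_dens_1_iff[OF sets.Int[OF assms(3,4)]]
proof (intro allI impI)
  fix \<epsilon> :: real assume "\<epsilon> > 0"
  then have "\<epsilon> / 2 > 0" by simp
  with assms have "\<forall>\<^sub>F r in at_top.
      measure lebesgue (sector_trunc \<alpha> r - A) < \<epsilon> / 2 * measure lebesgue (sector_trunc \<alpha> r)"
    "\<forall>\<^sub>F r in at_top.
      measure lebesgue (sector_trunc \<alpha> r - B) < \<epsilon> / 2 * measure lebesgue (sector_trunc \<alpha> r)"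
    by (blast dest: has_dens_1_iff[THEN iffD1, rotated])+
  then show "\<forall>\<^sub>F r in at_top. measure lebesgue (sector_trunc \<alpha> r - A \<inter> B)
      < \<epsilon> * measure lebesgue (sector_trunc \<alpha> r)"
  proof eventually_elim
    case (elim r)
    then show ?case using measure_sector_trunc_Diff_Int_le[OF assms(3,4), of r] by linarith
  qed
qed

text \<open>Two sets of upper density one may be large at different radii. Here the radii good for
  \<open>B\<close> are eventually all radii, so they meet the unbounded set of radii good for
  \<open>A\<close>.\<close>

lemma upper_dens_1_Int:
  assumes "upper_dens \<alpha> A = 1" "has_dens \<alpha> B 1" "A \<in> sets lebesgue" "B \<in> sets lebesgue"
  shows "upper_dens \<alpha> (A \<inter> B) = 1"
  unfolding upper_dens_eq_1_iff[OF sets.Int[OF assms(3,4)]]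
proof (intro allI impI)
  fix \<epsilon> :: real assume "\<epsilon> > 0"
  then have "\<epsilon> / 2 > 0" by simp
  with assms have "\<exists>\<^sub>F r in at_top.
      measure lebesgue (sector_trunc \<alpha> r - A) < \<epsilon> / 2 * measure lebesgue (sector_trunc \<alpha> r)"
    "\<forall>\<^sub>F r in at_top.
      measure lebesgue (sector_trunc \<alpha> r - B) < \<epsilon> / 2 * measure lebesgue (sector_trunc \<alpha> r)"
    by (blast dest: has_dens_1_iff[THEN iffD1, rotated] upper_dens_eq_1_iff[THEN iffD1, rotated])+
  from frequently_eventually_conj[OF this]
  show "\<exists>\<^sub>F r in at_top. measure lebesgue (sector_trunc \<alpha> r - A \<inter> B)
      < \<epsilon> * measure lebesgue (sector_trunc \<alpha> r)"
  proof (rule frequently_elim1)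
    fix r
    assume "measure lebesgue (sector_trunc \<alpha> r - B) < \<epsilon> / 2 * measure lebesgue (sector_trunc \<alpha> r) \<and>
      measure lebesgue (sector_trunc \<alpha> r - A) < \<epsilon> / 2 * measure lebesgue (sector_trunc \<alpha> r)"
    then show "measure lebesgue (sector_trunc \<alpha> r - A \<inter> B) < \<epsilon> * measure lebesgue (sector_trunc \<alpha> r)"
      using measure_sector_trunc_Diff_Int_le[OF assms(3,4), of r] by linarith
  qed
qed

lemma has_dens_sector: "has_dens \<alpha> (sector \<alpha>) 1"
proof -
  have *: "sector_trunc \<alpha> r - sector \<alpha> = {}" for r unfolding sector_trunc_def by auto
  have "\<forall>\<^sub>F r in at_top. measure lebesgue (sector_trunc \<alpha> r - sector \<alpha>)
      < \<epsilon> * measure lebesgue (sector_trunc \<alpha> r)" if "\<epsilon> > 0" for \<epsilon>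
    unfolding * using eventually_measure_sector_trunc_pos that by (auto elim: eventually_mono)
  then show ?thesis
    using closed_sector by (subst has_dens_1_iff) auto
qed

text \<open>A bounded piece has fixed finite measure while the truncated sectors have measure
  tending to infinity.\<close>

lemma has_dens_outside: "has_dens \<alpha> (- ball 0 R) 1"
proof (subst has_dens_1_iff)
  show "\<forall>\<epsilon>>0. \<forall>\<^sub>F r in at_top. measure lebesgue (sector_trunc \<alpha> r - - ball 0 R)
      < \<epsilon> * measure lebesgue (sector_trunc \<alpha> r)"
  proof (intro allI impI)
    fix \<epsilon> :: real assume "\<epsilon> > 0"
    have "\<forall>\<^sub>F r in at_top. measure lebesgue (sector_trunc \<alpha> R) / \<epsilon> < measure lebesgue (sector_trunc \<alpha> r)"
      using measure_sector_trunc_at_top by (simp add: filterlim_at_top_dense)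
    then show "\<forall>\<^sub>F r in at_top. measure lebesgue (sector_trunc \<alpha> r - - ball 0 R)
        < \<epsilon> * measure lebesgue (sector_trunc \<alpha> r)"
    proof eventually_elim
      case (elim r)
      have "measure lebesgue (sector_trunc \<alpha> r - - ball 0 R) \<le> measure lebesgue (sector_trunc \<alpha> R)"
        by (intro measure_mono_fmeasurable sector_trunc_lmeasurable sets.Diff sector_trunc_sets)
          (auto simp: sector_trunc_def)
      then show ?case using elim \<open>\<epsilon> > 0\<close> by (simp add: field_simps)
    qed
  qed
qed auto

text \<open>A diagonal argument: \<open>A\<close> follows \<open>E m\<close> on the m-th of a
  sequence of annuli, each reaching so far out that the ball inside it is negligible. As the sets
  decrease, beyond the m-th inner radius \<open>A\<close> stays in \<open>E m\<close>.\<close>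

lemma upper_dens_1_diagonal:
  assumes E: "\<And>m. E m \<in> sets lebesgue" "\<And>m. upper_dens \<alpha> (E m) = 1" and "decseq E"
  obtains A where "A \<in> sets lebesgue" "A \<subseteq> E 0" "upper_dens \<alpha> A = 1"
    "\<And>m. \<exists>R. \<forall>t\<in>A. R \<le> norm t \<longrightarrow> t \<in> E m"
proof -
  have step: "\<exists>s. r + 1 \<le> s \<and> measure lebesgue (sector_trunc \<alpha> s - (E m \<inter> - ball 0 r))
      < inverse (Suc m) * measure lebesgue (sector_trunc \<alpha> s)" for m r
  proof -
    have "upper_dens \<alpha> (E m \<inter> - ball 0 r) = 1"
      using E has_dens_outside by (intro upper_dens_1_Int) auto
    then have "\<exists>\<^sub>F s in at_top. measure lebesgue (sector_trunc \<alpha> s - (E m \<inter> - ball 0 r))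
        < inverse (Suc m) * measure lebesgue (sector_trunc \<alpha> s)"
      using E by (subst (asm) upper_dens_eq_1_iff) auto
    from frequently_eventually_conj[OF this eventually_ge_at_top[of "r + 1"]]
    show ?thesis by (auto dest: frequently_ex)
  qed
  \<comment> \<open>The invariant on single radii is the trivial \<open>True\<close>; only
    consecutive radii are related. The unit gap between them makes the sequence tend to
    infinity.\<close>
  have "\<exists>\<rho>. \<forall>m. True \<and> \<rho> m + 1 \<le> \<rho> (Suc m) \<and>
      measure lebesgue (sector_trunc \<alpha> (\<rho> (Suc m)) - (E m \<inter> - ball 0 (\<rho> m)))
      < inverse (Suc m) * measure lebesgue (sector_trunc \<alpha> (\<rho> (Suc m)))"
    by (rule dependent_nat_choice[where P = "\<lambda>_ _. True"]) (use step in simp_all)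
  then obtain \<rho> where \<rho>: "\<And>m. \<rho> m + 1 \<le> \<rho> (Suc m)"
      "\<And>m. measure lebesgue (sector_trunc \<alpha> (\<rho> (Suc m)) - (E m \<inter> - ball 0 (\<rho> m)))
      < inverse (Suc m) * measure lebesgue (sector_trunc \<alpha> (\<rho> (Suc m)))"
    by blast
  have \<rho>_ge: "\<rho> m \<ge> \<rho> 0 + m" for m
  proof (induction m)
    case (Suc m)
    then show ?case using \<rho>(1)[of m] by simp
  qed simp
  have \<rho>_top: "filterlim \<rho> at_top sequentially"
    by (rule filterlim_at_top_mono[OF
          filterlim_tendsto_add_at_top[OF tendsto_const[of "\<rho> 0"] filterlim_real_sequentially]])
      (use \<rho>_ge in simp)
  have \<rho>_mono: "mono \<rho>" by (rule incseq_SucI) (rule order_trans[OF _ \<rho>(1)], simp)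
  define A where "A = (\<Union>m. E m \<inter> (ball 0 (\<rho> (Suc m)) - ball 0 (\<rho> m)))"
  have A: "A \<in> sets lebesgue"
    unfolding A_def by (intro sets.countable_UN'' sets.Int sets.Diff E) auto
  show ?thesis
  proof (rule that[OF A])
    show "A \<subseteq> E 0" unfolding A_def using decseqD[OF \<open>decseq E\<close>] by blast
    show "\<exists>R. \<forall>t\<in>A. R \<le> norm t \<longrightarrow> t \<in> E m" for m
    proof (intro exI ballI impI)
      fix t assume t: "t \<in> A" "\<rho> m \<le> norm t"
      then obtain n where n: "t \<in> E n" "norm t < \<rho> (Suc n)" by (auto simp: A_def)
      then have "\<rho> m < \<rho> (Suc n)" using t by simp
      then have "m \<le> n" using \<rho>_mono by (meson monoD not_less not_less_eq_eq)
      then show "t \<in> E m" using n decseqD[OF \<open>decseq E\<close>] by blast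
    qed
    show "upper_dens \<alpha> A = 1"
      unfolding upper_dens_eq_1_iff[OF A]
    proof (intro allI impI)
      fix \<epsilon> :: real assume \<epsilon>: "\<epsilon> > 0"
      have small: "\<forall>\<^sub>F m in sequentially. inverse (Suc m) < \<epsilon>"
        using \<epsilon> LIMSEQ_inverse_real_of_nat by (rule order_tendstoD(2)[rotated])
      have "\<forall>\<^sub>F m in sequentially. measure lebesgue (sector_trunc \<alpha> (\<rho> (Suc m)) - A)
          < \<epsilon> * measure lebesgue (sector_trunc \<alpha> (\<rho> (Suc m)))"
        using small
      proof eventually_elim
        case (elim m)
        have "measure lebesgue (sector_trunc \<alpha> (\<rho> (Suc m)) - A) \<le>
            measure lebesgue (sector_trunc \<alpha> (\<rho> (Suc m)) - (E m \<inter> - ball 0 (\<rho> m)))"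
          using E A by (intro measure_sector_trunc_Diff_mono) (auto simp: A_def sector_trunc_def)
        also have "\<dots> < inverse (Suc m) * measure lebesgue (sector_trunc \<alpha> (\<rho> (Suc m)))"
          by (rule \<rho>)
        also have "\<dots> \<le> \<epsilon> * measure lebesgue (sector_trunc \<alpha> (\<rho> (Suc m)))"
          using elim by (intro mult_right_mono) auto
        finally show ?case .
      qed
      then have "\<exists>\<^sub>F m in sequentially. measure lebesgue (sector_trunc \<alpha> (\<rho> (Suc m)) - A)
          < \<epsilon> * measure lebesgue (sector_trunc \<alpha> (\<rho> (Suc m)))"
        by (rule eventually_frequently[rotated]) simp
      moreover have "filterlim (\<lambda>m. \<rho> (Suc m)) at_top sequentially"
        using \<rho>_top by (rule filterlim_compose) (rule filterlim_Suc)
      ultimately show "\<exists>\<^sub>F r in at_top. measure lebesgue (sector_trunc \<alpha> r - A)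
          < \<epsilon> * measure lebesgue (sector_trunc \<alpha> r)"
        by (auto simp: frequently_def filterlim_iff)
    qed
  qed
qed

end

subsection \<open>Orbits of a semigroup over a sector\<close>

locale sector_semigroup = normed_space_over smul + sector_angle \<alpha>
  for smul :: "'k::{real_normed_field,euclidean_space} \<Rightarrow> 'a::banach \<Rightarrow> 'a" and \<alpha> +
  fixes T :: "complex \<Rightarrow> 'a \<Rightarrow> 'a"
  assumes C0: "C0_semigroup smul \<alpha> T"
begin

section \<open>Linearity, measurability and boundedness of orbits\<close>

lemma T_hom: "t \<in> sector \<alpha> \<Longrightarrow> module_hom smul smul (T t)"
  using C0 unfolding C0_semigroup_def by (auto simp: Vector_Spaces.linear_def)

lemmas T_add = T_hom[THEN module_hom.add]
  and T_smul = T_hom[THEN module_hom.scale]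
  and T_zero = T_hom[THEN module_hom.zero]

lemma scaleR_eq_smul: "r *\<^sub>R x = smul (of_real r) x"
  by (simp add: smul_of_real)

lemma T_scaleR: "t \<in> sector \<alpha> \<Longrightarrow> T t (r *\<^sub>R x) = r *\<^sub>R T t x"
  unfolding scaleR_eq_smul by (rule T_smul)

lemma continuous_on_orbit: "continuous_on (sector \<alpha>) (\<lambda>t. T t x)"
  using C0 unfolding C0_semigroup_def continuous_on_def by blast

lemma continuous_on_norm_orbit [continuous_intros]: "continuous_on (sector \<alpha>) (\<lambda>t. norm (T t x))"
  by (intro continuous_on_norm continuous_on_orbit)

text \<open>Continuity is available on the sector only, so the preimage is relatively open there:
  the intersection of an open set with the closed sector.\<close>

lemma sets_lebesgue_preimage:
  fixes f :: "complex \<Rightarrow> real"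
  assumes "continuous_on (sector \<alpha>) f" "open U"
  shows "{t \<in> sector \<alpha>. f t \<in> U} \<in> sets lebesgue"
proof -
  have "openin (top_of_set (sector \<alpha>)) (sector \<alpha> \<inter> f -` U)"
    using assms by (rule continuous_openin_preimage_gen)
  then obtain V where "open V" "sector \<alpha> \<inter> f -` U = sector \<alpha> \<inter> V"
    by (auto simp: openin_open)
  moreover have "{t \<in> sector \<alpha>. f t \<in> U} = sector \<alpha> \<inter> f -` U" by auto
  ultimately show ?thesis using closed_sector by auto
qed

lemma sets_lebesgue_sublevel:
  fixes f :: "complex \<Rightarrow> real"
  shows "continuous_on (sector \<alpha>) f \<Longrightarrow> {t \<in> sector \<alpha>. f t < c} \<in> sets lebesgue"
    and "continuous_on (sector \<alpha>) f \<Longrightarrow> {t \<in> sector \<alpha>. c < f t} \<in> sets lebesgue"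
  using sets_lebesgue_preimage[of f "{..<c}"] sets_lebesgue_preimage[of f "{c<..}"] by auto

lemmas sets_lebesgue_orbit_norm [simp] = sets_lebesgue_sublevel[OF continuous_on_norm_orbit]

text \<open>Baire's theorem, applied to the closed sets of vectors whose orbit is bounded by \<open>n\<close> on the
  truncated sector.\<close>

lemma locally_bounded:
  obtains C where "C > 0" "\<And>t x. t \<in> sector_trunc \<alpha> r \<Longrightarrow> norm (T t x) \<le> C * norm x"
proof -
  let ?K = "sector \<alpha> \<inter> cball 0 r"
  define F where "F n = {x. \<forall>t\<in>?K. norm (T t x) \<le> real n}" for n :: nat
  have closed: "closed (F n)" for n
  proof -
    have "F n = (\<Inter>t\<in>?K. {x. norm (T t x) \<le> real n})" by (auto simp: F_def)
    moreover have "continuous_on UNIV (T t)" if "t \<in> ?K" for t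
      using C0 that by (simp add: C0_semigroup_def)
    ultimately show ?thesis
      by (auto intro!: closed_INT closed_Collect_le continuous_on_norm)
  qed
  \<comment> \<open>Pointwise boundedness: the closed truncated sector is compact and the orbit of
    \<open>x\<close> is continuous on it.\<close>
  have "x \<in> (\<Union>n. F n)" for x
  proof -
    have "compact ?K" using closed_sector by (intro closed_Int_compact) auto
    then have "compact ((\<lambda>t. norm (T t x)) ` ?K)"
      by (intro compact_continuous_image continuous_on_subset[OF continuous_on_norm_orbit]) auto
    then obtain B where B: "\<And>t. t \<in> ?K \<Longrightarrow> norm (T t x) \<le> B"
      using compact_imp_bounded[THEN bounded_iff[THEN iffD1]] by fastforce
    obtain n where "B \<le> real n" using real_arch_simple by blast
    then have "x \<in> F n" using B order_trans unfolding F_def by blast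
    then show ?thesis by blast
  qed
  then have "(\<Union>n. F n) = UNIV" by auto
  then have "interior (\<Union>(range F)) \<noteq> {}" by simp
  moreover have "interior (\<Union>(range F)) = {}" if "\<And>n. interior (F n) = {}"
    using Baire_category_alt[of "euclidean :: 'a topology" "range F"] closed that
    by (auto simp: completely_metrizable_space_euclidean)
  ultimately obtain n where "interior (F n) \<noteq> {}" by blast
  then obtain x0 \<rho> where \<rho>: "\<rho> > 0" "ball x0 \<rho> \<subseteq> F n"
    by (meson all_not_in_conv mem_interior)
  \<comment> \<open>A small \<open>z\<close> is the difference of \<open>x0 + z\<close> and
    \<open>x0\<close>, both in \<open>F n\<close>; this costs the factor 2.\<close>
  have small: "norm (T t z) \<le> 2 * real n" if "t \<in> ?K" "norm z < \<rho>" for t z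
  proof -
    have "x0 \<in> F n" "x0 + z \<in> F n" using \<rho> that by (auto simp: dist_norm subset_eq)
    then have "norm (T t x0) \<le> n" "norm (T t (x0 + z)) \<le> n" using that by (auto simp: F_def)
    moreover have "T t z = T t (x0 + z) - T t x0" using that by (simp add: T_add)
    ultimately show ?thesis
      using norm_triangle_ineq4[of "T t (x0 + z)" "T t x0"] by simp
  qed
  show ?thesis
  proof
    \<comment> \<open>The 4 combines the bound \<open>2 * real n\<close> with the rescaling of
      \<open>x\<close> to norm \<open>\<rho> / 2\<close> below; the summand 1 keeps the constant
      positive when \<open>n = 0\<close>.\<close>
    show "0 < 4 * real n / \<rho> + 1" using \<rho> by (intro add_nonneg_pos) auto
    fix t x assume "t \<in> sector_trunc \<alpha> r"
    then have t: "t \<in> ?K" by (auto simp: sector_trunc_def)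
    show "norm (T t x) \<le> (4 * real n / \<rho> + 1) * norm x"
    proof (cases "x = 0")
      case True then show ?thesis using t by (simp add: T_zero)
    next
      case False
      define a where "a = \<rho> / (2 * norm x)"
      have a: "a > 0" using False \<rho> by (simp add: a_def)
      have "norm (a *\<^sub>R x) < \<rho>" using \<rho> False by (simp add: a_def)
      then have "norm (T t (a *\<^sub>R x)) \<le> 2 * real n" using small t by blast
      then have "a * norm (T t x) \<le> 2 * real n" using t a by (simp add: T_scaleR)
      then have "norm (T t x) \<le> 4 * real n / \<rho> * norm x"
        using False \<rho> by (simp add: a_def field_simps)
      also have "\<dots> \<le> (4 * real n / \<rho> + 1) * norm x" by (intro mult_right_mono) auto
      finally show ?thesis .
    qed
  qed
qed

text \<open>This permits applying \<open>T t\<close> to an infinite series term by term.\<close>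

lemma bounded_linear_T: "t \<in> sector \<alpha> \<Longrightarrow> bounded_linear (T t)"
proof -
  assume t: "t \<in> sector \<alpha>"
  obtain C where "\<And>t' x. t' \<in> sector_trunc \<alpha> (norm t + 1) \<Longrightarrow> norm (T t' x) \<le> C * norm x"
    using locally_bounded by metis
  then have "norm (T t x) \<le> norm x * C" for x
    using t by (simp add: sector_trunc_def mult.commute)
  then show ?thesis using t by (intro bounded_linear_intro) (auto simp: T_add T_scaleR)
qed

lemma norm_T_add_le: "t \<in> sector \<alpha> \<Longrightarrow> norm (T t (x + y)) \<le> norm (T t x) + norm (T t y)"
  by (simp add: T_add norm_triangle_ineq)

lemma norm_T_add_ge: "t \<in> sector \<alpha> \<Longrightarrow> norm (T t y) - norm (T t x) \<le> norm (T t (x + y))"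
  using norm_triangle_ineq2[of "T t y" "- T t x"] by (simp add: T_add add.commute)

lemma DAsym0_has_dens: "y \<in> DAsym0 \<alpha> T \<Longrightarrow> \<epsilon> > 0 \<Longrightarrow> has_dens \<alpha> {t \<in> sector \<alpha>. norm (T t y) < \<epsilon>} 1"
  by (simp add: DAsym0_def)

text \<open>Finitely many sets of density one still intersect in density one. In the gliding hump
  this makes all earlier vectors small together on most of every large sector.\<close>

lemma DAsym0_sum_has_dens:
  fixes k :: nat
  assumes "\<And>j. j < k \<Longrightarrow> u j \<in> DAsym0 \<alpha> T" "\<epsilon> > 0"
  shows "has_dens \<alpha> {t \<in> sector \<alpha>. (\<Sum>j<k. norm (T t (u j))) < \<epsilon>} 1"
  using assms
proof (induction k arbitrary: \<epsilon>)
  case 0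
  then show ?case using has_dens_sector by simp
next
  case (Suc k)
  let ?E = "{t \<in> sector \<alpha>. (\<Sum>j<k. norm (T t (u j))) < \<epsilon> / 2}"
  let ?F = "{t \<in> sector \<alpha>. norm (T t (u k)) < \<epsilon> / 2}"
  have sets: "{t \<in> sector \<alpha>. (\<Sum>j<k. norm (T t (u j))) < c} \<in> sets lebesgue" for c k
    by (intro sets_lebesgue_sublevel continuous_intros)
  have "has_dens \<alpha> (?E \<inter> ?F) 1"
    using Suc.prems by (intro has_dens_1_Int Suc.IH DAsym0_has_dens sets sets_lebesgue_orbit_norm) auto
  then show ?case
  proof (rule has_dens_1_mono)
    show "?E \<inter> ?F \<in> sets lebesgue"
      by (intro sets.Int sets sets_lebesgue_orbit_norm)
    show "?E \<inter> ?F \<inter> sector \<alpha> \<subseteq> {t \<in> sector \<alpha>. (\<Sum>j<Suc k. norm (T t (u j))) < \<epsilon>}" by auto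
  qed (rule sets)
qed

lemma subspace_DAsym0: "subspace (DAsym0 \<alpha> T)"
proof (rule subspaceI)
  have "{t \<in> sector \<alpha>. norm (T t 0) < \<epsilon>} = sector \<alpha>" if "\<epsilon> > 0" for \<epsilon>
    using that by (auto simp: T_zero)
  then show "0 \<in> DAsym0 \<alpha> T" using has_dens_sector by (simp add: DAsym0_def)
next
  fix x y assume xy: "x \<in> DAsym0 \<alpha> T" "y \<in> DAsym0 \<alpha> T"
  show "x + y \<in> DAsym0 \<alpha> T"
    unfolding DAsym0_def
  proof (intro CollectI allI impI)
    fix \<epsilon> :: real assume "\<epsilon> > 0"
    then have "has_dens \<alpha> ({t \<in> sector \<alpha>. norm (T t x) < \<epsilon> / 2} \<inter> {t \<in> sector \<alpha>. norm (T t y) < \<epsilon> / 2}) 1"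
      using xy by (intro has_dens_1_Int DAsym0_has_dens sets_lebesgue_orbit_norm) auto
    then show "has_dens \<alpha> {t \<in> sector \<alpha>. norm (T t (x + y)) < \<epsilon>} 1"
    proof (rule has_dens_1_mono)
      show "{t \<in> sector \<alpha>. norm (T t x) < \<epsilon> / 2} \<inter> {t \<in> sector \<alpha>. norm (T t y) < \<epsilon> / 2} \<inter> sector \<alpha>
          \<subseteq> {t \<in> sector \<alpha>. norm (T t (x + y)) < \<epsilon>}"
        using norm_T_add_le[of _ x y] by force
    qed (intro sets.Int sets_lebesgue_orbit_norm)+
  qed
next
  fix c x assume x: "x \<in> DAsym0 \<alpha> T"
  show "smul c x \<in> DAsym0 \<alpha> T"
    unfolding DAsym0_def
  proof (intro CollectI allI impI)
    fix \<epsilon> :: real assume "\<epsilon> > 0"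
    \<comment> \<open>The added 1 allows division also when \<open>c = 0\<close>.\<close>
    have pos: "norm c + 1 > 0" by (intro add_nonneg_pos) auto
    then have "has_dens \<alpha> {t \<in> sector \<alpha>. norm (T t x) < \<epsilon> / (norm c + 1)} 1"
      using x \<open>\<epsilon> > 0\<close> by (intro DAsym0_has_dens) auto
    then show "has_dens \<alpha> {t \<in> sector \<alpha>. norm (T t (smul c x)) < \<epsilon>} 1"
    proof (rule has_dens_1_mono)
      have "norm (T t (smul c x)) < \<epsilon>"
        if t: "t \<in> sector \<alpha>" "norm (T t x) < \<epsilon> / (norm c + 1)" for t
      proof -
        have "norm (T t (smul c x)) \<le> (norm c + 1) * norm (T t x)"
          using t by (simp add: T_smul norm_smul algebra_simps)
        also have "\<dots> < \<epsilon>" using t(2) pos by (simp add: field_simps)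
        finally show ?thesis .
      qed
      then show "{t \<in> sector \<alpha>. norm (T t x) < \<epsilon> / (norm c + 1)} \<inter> sector \<alpha>
          \<subseteq> {t \<in> sector \<alpha>. norm (T t (smul c x)) < \<epsilon>}" by auto
    qed auto
  qed
qed

section \<open>Irregular vectors, sensitivity and large orbits\<close>

text \<open>Fixed thresholds are easier to verify than limits along one set. Diagonalising over the
  thresholds \<open>inverse (Suc m)\<close> and \<open>real m\<close> produces the single sets
  \<open>A\<close> and \<open>B\<close>.\<close>

lemma distributionally_irregularI:
  assumes small: "\<And>\<epsilon>. \<epsilon> > 0 \<Longrightarrow> upper_dens \<alpha> {t \<in> sector \<alpha>. norm (T t x) < \<epsilon>} = 1"
    and large: "\<And>K. upper_dens \<alpha> {t \<in> sector \<alpha>. K < norm (T t x)} = 1"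
  shows "distributionally_irregular \<alpha> T x"
proof -
  define E where "E m = {t \<in> sector \<alpha>. norm (T t x) < inverse (Suc m)}" for m
  have "decseq E"
    unfolding decseq_def E_def by (auto elim!: order.strict_trans2 simp del: of_nat_Suc)
  moreover have "E m \<in> sets lebesgue" "upper_dens \<alpha> (E m) = 1" for m
    using small by (simp_all add: E_def del: of_nat_Suc)
  ultimately obtain A where A: "A \<in> sets lebesgue" "A \<subseteq> E 0" "upper_dens \<alpha> A = 1"
      "\<And>m. \<exists>R. \<forall>t\<in>A. R \<le> norm t \<longrightarrow> t \<in> E m"
    using upper_dens_1_diagonal[of E] by blast
  define F where "F m = {t \<in> sector \<alpha>. real m < norm (T t x)}" for m
  have "decseq F" unfolding decseq_def F_def by auto
  moreover have "F m \<in> sets lebesgue" "upper_dens \<alpha> (F m) = 1" for m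
    using large by (simp_all add: F_def del: of_nat_Suc)
  ultimately obtain B where B: "B \<in> sets lebesgue" "B \<subseteq> F 0" "upper_dens \<alpha> B = 1"
      "\<And>m. \<exists>R. \<forall>t\<in>B. R \<le> norm t \<longrightarrow> t \<in> F m"
    using upper_dens_1_diagonal[of F] by blast
  have "((\<lambda>t. norm (T t x)) \<longlongrightarrow> 0) (inf at_infinity (principal A))"
  proof (rule tendstoI)
    fix e :: real assume "e > 0"
    then obtain m where m: "inverse (Suc m) < e" using reals_Archimedean by blast
    obtain R where R: "\<forall>t\<in>A. R \<le> norm t \<longrightarrow> t \<in> E m" using A(4) by blast
    show "\<forall>\<^sub>F t in inf at_infinity (principal A). dist (norm (T t x)) 0 < e"
      unfolding eventually_inf_principal eventually_at_infinity
      using R m by (intro exI[of _ R]) (force simp: E_def)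
  qed
  moreover have "filterlim (\<lambda>t. norm (T t x)) at_top (inf at_infinity (principal B))"
    unfolding filterlim_at_top
  proof
    fix Z :: real
    obtain m where m: "Z \<le> real m" using real_arch_simple by blast
    obtain R where R: "\<forall>t\<in>B. R \<le> norm t \<longrightarrow> t \<in> F m" using B(4) by blast
    show "\<forall>\<^sub>F t in inf at_infinity (principal B). Z \<le> norm (T t x)"
      unfolding eventually_inf_principal eventually_at_infinity
      using R m by (intro exI[of _ R]) (force simp: F_def)
  qed
  moreover have "A \<subseteq> sector \<alpha>" "B \<subseteq> sector \<alpha>" using A B by (auto simp: E_def F_def)
  ultimately show ?thesis unfolding distributionally_irregular_def using A B by blast
qed

text \<open>Outside a large ball the set \<open>B\<close> lies in the superlevel set, and removing a
  ball does not affect upper density one.\<close>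

lemma distributionally_irregular_unbounded:
  assumes "distributionally_irregular \<alpha> T x"
  shows "upper_dens \<alpha> {t \<in> sector \<alpha>. K < norm (T t x)} = 1"
proof -
  obtain B where B: "B \<in> sets lebesgue" "B \<subseteq> sector \<alpha>" "upper_dens \<alpha> B = 1"
      "filterlim (\<lambda>t. norm (T t x)) at_top (inf at_infinity (principal B))"
    using assms unfolding distributionally_irregular_def by blast
  have "\<forall>\<^sub>F t in inf at_infinity (principal B). K < norm (T t x)"
    using B(4) by (simp add: filterlim_at_top_dense)
  then obtain R where R: "\<And>t. t \<in> B \<Longrightarrow> R \<le> norm t \<Longrightarrow> K < norm (T t x)"
    by (auto simp: eventually_inf_principal eventually_at_infinity)
  have "upper_dens \<alpha> (B \<inter> - ball 0 R) = 1"
    using B has_dens_outside by (intro upper_dens_1_Int) auto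
  then show ?thesis
    by (rule upper_dens_1_mono) (use B R in \<open>auto simp: not_less\<close>)
qed

text \<open>The sensitivity constant can be taken to be 1: for a perturbation
  \<open>c *\<^sub>R z\<close> the orbit difference exceeds 1 exactly where the orbit of
  \<open>z\<close> exceeds \<open>1 / c\<close>, and every such level is exceeded with upper density
  one.\<close>

lemma sensitive_if_irregular:
  assumes "distributionally_irregular \<alpha> T z"
  shows "distributionally_sensitive \<alpha> T"
  unfolding distributionally_sensitive_def
proof (intro exI[of _ 1] conjI allI impI)
  fix x :: 'a and \<epsilon> :: real assume "\<epsilon> > 0"
  define c where "c = \<epsilon> / (norm z + 1)"
  have pos: "norm z + 1 > 0" by (intro add_nonneg_pos) auto
  then have c: "c > 0" using \<open>\<epsilon> > 0\<close> by (simp add: c_def)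
  have "c * norm z < \<epsilon>"
    using \<open>\<epsilon> > 0\<close> pos by (simp add: c_def field_simps)
  then have "norm (x - (x + c *\<^sub>R z)) < \<epsilon>" using c by simp
  moreover have "{t \<in> sector \<alpha>. 1 < norm (T t x - T t (x + c *\<^sub>R z))}
      = {t \<in> sector \<alpha>. 1 / c < norm (T t z)}"
    using c by (auto simp: T_add T_scaleR field_simps)
  ultimately show "\<exists>y. norm (x - y) < \<epsilon> \<and>
      upper_dens \<alpha> {t \<in> sector \<alpha>. 1 < norm (T t x - T t y)} = 1"
    using distributionally_irregular_unbounded[OF assms, of "1 / c"]
    by (intro exI[of _ "x + c *\<^sub>R z"]) simp
qed simp

text \<open>Linearity turns sensitivity at 0 into arbitrarily large orbits of arbitrarily small
  vectors: start with norm below \<open>\<epsilon> / c\<close> and multiply by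
  \<open>c = K / \<delta>\<close>.\<close>

lemma sensitive_imp_unbounded:
  assumes "distributionally_sensitive \<alpha> T" "\<epsilon> > 0" "K > 0"
  obtains y where "norm y < \<epsilon>" "upper_dens \<alpha> {t \<in> sector \<alpha>. K < norm (T t y)} = 1"
proof -
  obtain \<delta> where \<delta>: "\<delta> > 0" "\<And>x \<epsilon>. \<epsilon> > 0 \<Longrightarrow> \<exists>y. norm (x - y) < \<epsilon> \<and>
      upper_dens \<alpha> {t \<in> sector \<alpha>. \<delta> < norm (T t x - T t y)} = 1"
    using assms(1) unfolding distributionally_sensitive_def by blast
  define c where "c = K / \<delta>"
  have c: "c > 0" using assms \<delta> by (simp add: c_def)
  obtain y where y: "norm (0 - y) < \<epsilon> / c"
      "upper_dens \<alpha> {t \<in> sector \<alpha>. \<delta> < norm (T t 0 - T t y)} = 1"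
    using \<delta>(2)[of "\<epsilon> / c" 0] assms c by auto
  have "{t \<in> sector \<alpha>. \<delta> < norm (T t 0 - T t y)} = {t \<in> sector \<alpha>. K < norm (T t (c *\<^sub>R y))}"
    using c \<delta> assms by (auto simp: T_zero T_scaleR c_def field_simps)
  then show ?thesis using that[of "c *\<^sub>R y"] y c by (simp add: field_simps)
qed

subsection \<open>The gliding hump\<close>


text \<open>One stage of the construction. Sensitivity gives \<open>y\<close> with large orbit, and
  \<open>s\<close> is fixed for \<open>y\<close>. Only then is \<open>y\<close> replaced by a nearby
  \<open>v\<close> in \<open>DAsym0 \<alpha> T\<close>, so close that the orbits differ by less than
  1 up to radius \<open>s\<close>; hence the level \<open>K + 1\<close> for
  \<open>y\<close>.\<close>

lemma unbounded_DAsym0_step: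
  fixes u :: "nat \<Rightarrow> 'a" and r :: "nat \<Rightarrow> real"
  assumes sens: "distributionally_sensitive \<alpha> T" and dense: "closure (DAsym0 \<alpha> T) = UNIV"
    and u: "\<And>j. j < k \<Longrightarrow> u j \<in> DAsym0 \<alpha> T" and pos: "\<epsilon> > 0" "\<eta> > 0" "K > 0"
  obtains v s where "v \<in> DAsym0 \<alpha> T" "norm v \<le> \<epsilon>" "R \<le> s"
    "\<And>j t. j < k \<Longrightarrow> t \<in> sector_trunc \<alpha> (r j) \<Longrightarrow> norm (T t v) \<le> \<epsilon>"
    "measure lebesgue (sector_trunc \<alpha> s -
        {t \<in> sector \<alpha>. (\<Sum>j<k. norm (T t (u j))) < \<eta> \<and> K < norm (T t v)})
      < \<eta> * measure lebesgue (sector_trunc \<alpha> s)"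
proof -
  \<comment> \<open>The sum of the absolute values dominates each of the finitely many earlier radii
    and is also defined for \<open>k = 0\<close>.\<close>
  obtain C where C: "C > 0" "\<And>t x. t \<in> sector_trunc \<alpha> (\<Sum>j<k. \<bar>r j\<bar>) \<Longrightarrow> norm (T t x) \<le> C * norm x"
    using locally_bounded by blast
  \<comment> \<open>Norm at most \<open>m\<close> ensures both smallness of \<open>v\<close> and
    smallness of its orbit on the earlier sectors.\<close>
  define m where "m = min \<epsilon> (\<epsilon> / C)"
  have m: "m > 0" "m \<le> \<epsilon>" "C * m \<le> \<epsilon>" using pos C by (auto simp: m_def min_def field_simps)
  obtain y where y: "norm y < m / 2" "upper_dens \<alpha> {t \<in> sector \<alpha>. K + 1 < norm (T t y)} = 1"
    using sensitive_imp_unbounded[OF sens, of "m / 2" "K + 1"] m pos by auto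
  let ?L = "{t \<in> sector \<alpha>. (\<Sum>j<k. norm (T t (u j))) < \<eta>}"
  let ?E = "{t \<in> sector \<alpha>. K + 1 < norm (T t y)}"
  have sets: "?L \<in> sets lebesgue" by (intro sets_lebesgue_sublevel continuous_intros)
  have E_sets: "?E \<inter> ?L \<in> sets lebesgue" by (intro sets.Int sets sets_lebesgue_orbit_norm)
  have "upper_dens \<alpha> (?E \<inter> ?L) = 1"
    using y(2) u pos sets by (intro upper_dens_1_Int DAsym0_sum_has_dens) auto
  then have "\<exists>\<^sub>F s in at_top. measure lebesgue (sector_trunc \<alpha> s - ?E \<inter> ?L)
      < \<eta> * measure lebesgue (sector_trunc \<alpha> s)"
    using upper_dens_eq_1_iff[OF E_sets] pos by blast
  from frequently_eventually_conj[OF this eventually_ge_at_top[of R]]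
  obtain s where s: "R \<le> s" "measure lebesgue (sector_trunc \<alpha> s - ?E \<inter> ?L)
      < \<eta> * measure lebesgue (sector_trunc \<alpha> s)"
    by (auto dest: frequently_ex)
  obtain C' where C': "C' > 0" "\<And>t x. t \<in> sector_trunc \<alpha> s \<Longrightarrow> norm (T t x) \<le> C' * norm x"
    using locally_bounded by blast
  \<comment> \<open>The first tolerance preserves \<open>norm v \<le> m\<close>; the second keeps
    the orbit of \<open>v\<close> within 1 of that of \<open>y\<close> up to radius
    \<open>s\<close>.\<close>
  have "0 < min (m / 2) (1 / C')" using m C' by simp
  then obtain v where v: "v \<in> DAsym0 \<alpha> T" "dist v y < min (m / 2) (1 / C')"
    using dense closure_approachable[of y "DAsym0 \<alpha> T"] by blast
  have "norm v \<le> norm (v - y) + norm y" using norm_triangle_ineq[of "v - y" y] by simp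
  then have norm_v: "norm v \<le> m" using v y by (simp add: dist_norm)
  show ?thesis
  proof (rule that[OF v(1) _ s(1)])
    show "norm v \<le> \<epsilon>" using norm_v m by simp
    show "norm (T t v) \<le> \<epsilon>" if "j < k" "t \<in> sector_trunc \<alpha> (r j)" for j t
    proof -
      have "r j \<le> \<bar>r j\<bar>" by simp
      also have "\<dots> \<le> (\<Sum>j<k. \<bar>r j\<bar>)" using that by (intro member_le_sum) auto
      finally have "norm (T t v) \<le> C * norm v"
        using that by (intro C) (auto simp: sector_trunc_def)
      also have "\<dots> \<le> C * m" using norm_v C by simp
      finally show ?thesis using m by simp
    qed
    have "norm (T t y) - 1 < norm (T t v)" if t: "t \<in> sector_trunc \<alpha> s" for t
    proof -
      have "T t y = T t (y - v) + T t v"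
        using T_add[of t "y - v" v] t by (simp add: sector_trunc_def)
      then have "norm (T t y) \<le> norm (T t (y - v)) + norm (T t v)"
        by (metis norm_triangle_ineq)
      moreover have "norm (T t (y - v)) \<le> C' * norm (y - v)" using C' t by blast
      moreover have "C' * norm (y - v) < 1"
        using v C' by (simp add: dist_norm norm_minus_commute field_simps)
      ultimately show ?thesis by linarith
    qed
    then have "measure lebesgue (sector_trunc \<alpha> s -
        {t \<in> sector \<alpha>. (\<Sum>j<k. norm (T t (u j))) < \<eta> \<and> K < norm (T t v)})
        \<le> measure lebesgue (sector_trunc \<alpha> s - ?E \<inter> ?L)"
    proof (intro measure_sector_trunc_Diff_mono E_sets)
      have "{t \<in> sector \<alpha>. (\<Sum>j<k. norm (T t (u j))) < \<eta> \<and> K < norm (T t v)}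
          = ?L \<inter> {t \<in> sector \<alpha>. K < norm (T t v)}" by auto
      then show "{t \<in> sector \<alpha>. (\<Sum>j<k. norm (T t (u j))) < \<eta> \<and> K < norm (T t v)} \<in> sets lebesgue"
        using sets by auto
    qed force
    then show "measure lebesgue (sector_trunc \<alpha> s -
        {t \<in> sector \<alpha>. (\<Sum>j<k. norm (T t (u j))) < \<eta> \<and> K < norm (T t v)})
      < \<eta> * measure lebesgue (sector_trunc \<alpha> s)"
      using s(2) by linarith
  qed
qed

text \<open>A gliding hump: on most of the truncated sector of radius \<open>s k\<close> the vector \<open>u k\<close> has a large
  orbit, while all other \<open>u j\<close> together are negligible there.\<close>

definition hump_set :: "(nat \<Rightarrow> 'a) \<Rightarrow> nat \<Rightarrow> complex set" where
  "hump_set u k = {t \<in> sector \<alpha>. (\<Sum>j<k. norm (T t (u j))) < inverse (Suc k) \<and> real (Suc k) < norm (T t (u k))}"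

text \<open>\<open>hump_set\<close> controls the earlier vectors at stage \<open>k\<close>, and the
  clause over \<open>j < k\<close> controls the later ones with geometric decay;
  \<open>real k \<le> s k\<close> makes the radii tend to infinity.\<close>

definition gliding_hump :: "(nat \<Rightarrow> 'a) \<Rightarrow> (nat \<Rightarrow> real) \<Rightarrow> bool" where
  "gliding_hump u s \<longleftrightarrow> (\<forall>k. u k \<in> DAsym0 \<alpha> T \<and> norm (u k) \<le> (1/2) ^ k \<and> real k \<le> s k \<and>
    (\<forall>j<k. \<forall>t\<in>sector_trunc \<alpha> (s j). norm (T t (u k)) \<le> (1/2) ^ k) \<and>
    measure lebesgue (sector_trunc \<alpha> (s k) - hump_set u k)
      < inverse (Suc k) * measure lebesgue (sector_trunc \<alpha> (s k)))"

lemma gliding_hump_exists: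
  assumes "distributionally_sensitive \<alpha> T" "closure (DAsym0 \<alpha> T) = UNIV"
  obtains u s where "gliding_hump u s"
proof -
  define P where "P f k p \<longleftrightarrow> (case p of (v, r) \<Rightarrow> v \<in> DAsym0 \<alpha> T \<and> norm v \<le> (1/2) ^ k \<and> real k \<le> r \<and>
    (\<forall>j<k. \<forall>t\<in>sector_trunc \<alpha> (snd (f j)). norm (T t v) \<le> (1/2) ^ k) \<and>
    measure lebesgue (sector_trunc \<alpha> r - {t \<in> sector \<alpha>.
        (\<Sum>j<k. norm (T t (fst (f j)))) < inverse (Suc k) \<and> real (Suc k) < norm (T t v)})
      < inverse (Suc k) * measure lebesgue (sector_trunc \<alpha> r))"
    for f :: "nat \<Rightarrow> 'a \<times> real" and k p
  have "\<exists>f. \<forall>k. P f k (f k)"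
  \<comment> \<open>Each stage depends on all earlier pairs of vector and radius, so
    \<open>P f k\<close> may look at \<open>f\<close> below \<open>k\<close> only.\<close>
  proof (rule dependent_wellorder_choice)
    fix p :: "'a \<times> real" and f g :: "nat \<Rightarrow> 'a \<times> real" and k :: nat
    assume "\<And>j. j < k \<Longrightarrow> f j = g j"
    then show "P f k p = P g k p" unfolding P_def by simp
  next
    fix k :: nat and f :: "nat \<Rightarrow> 'a \<times> real"
    assume "\<And>j. j < k \<Longrightarrow> P f j (f j)"
    then have D: "fst (f j) \<in> DAsym0 \<alpha> T" if "j < k" for j
      using that unfolding P_def by (auto simp: case_prod_beta)
    have pos: "(1/2::real) ^ k > 0" "inverse (real (Suc k)) > 0" "real (Suc k) > 0" by auto
    show "\<exists>p. P f k p"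
    proof (rule unbounded_DAsym0_step[OF assms, of k "\<lambda>j. fst (f j)" _ _ _ "real k" "\<lambda>j. snd (f j)",
            OF D pos])
      fix v r
      assume "v \<in> DAsym0 \<alpha> T" "norm v \<le> (1/2) ^ k" "real k \<le> r"
        "\<And>j t. j < k \<Longrightarrow> t \<in> sector_trunc \<alpha> (snd (f j)) \<Longrightarrow> norm (T t v) \<le> (1/2) ^ k"
        "measure lebesgue (sector_trunc \<alpha> r - {t \<in> sector \<alpha>.
            (\<Sum>j<k. norm (T t (fst (f j)))) < inverse (Suc k) \<and> real (Suc k) < norm (T t v)})
          < inverse (Suc k) * measure lebesgue (sector_trunc \<alpha> r)"
      then show "\<exists>p. P f k p" unfolding P_def by (intro exI[of _ "(v, r)"]) simp
    qed
  qed
  then obtain f where "\<And>k. P f k (f k)" by blast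
  then have "gliding_hump (\<lambda>k. fst (f k)) (\<lambda>k. snd (f k))"
    unfolding gliding_hump_def hump_set_def P_def by (auto simp: case_prod_beta)
  then show ?thesis by (rule that)
qed

section \<open>Series along a gliding hump\<close>

context
  fixes u :: "nat \<Rightarrow> 'a" and s :: "nat \<Rightarrow> real"
  assumes hump: "gliding_hump u s"
begin

lemma hump_set_sets: "hump_set u k \<in> sets lebesgue"
proof -
  have "hump_set u k = {t \<in> sector \<alpha>. (\<Sum>j<k. norm (T t (u j))) < inverse (Suc k)} \<inter>
      {t \<in> sector \<alpha>. real (Suc k) < norm (T t (u k))}"
    unfolding hump_set_def by auto
  also have "\<dots> \<in> sets lebesgue"
    by (intro sets.Int sets_lebesgue_sublevel continuous_intros)
  finally show ?thesis .
qed

lemma hump_radius_at_top: "filterlim s at_top sequentially"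
  by (rule filterlim_at_top_mono[OF filterlim_real_sequentially])
    (use hump in \<open>simp add: gliding_hump_def\<close>)

text \<open>The radii \<open>s k\<close> witness the upper density: they tend to infinity, and the
  part missed by the hump set has proportion below 1/(k+1).\<close>

lemma upper_dens_1_along_humps:
  assumes "E \<in> sets lebesgue" "\<exists>\<^sub>F k in sequentially. sector_trunc \<alpha> (s k) \<inter> hump_set u k \<subseteq> E"
  shows "upper_dens \<alpha> E = 1"
  unfolding upper_dens_eq_1_iff[OF assms(1)]
proof (intro allI impI)
  fix \<epsilon> :: real assume \<epsilon>: "\<epsilon> > 0"
  have small: "\<forall>\<^sub>F k in sequentially. inverse (Suc k) < \<epsilon>"
    using \<epsilon> LIMSEQ_inverse_real_of_nat by (rule order_tendstoD(2)[rotated])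
  have "\<exists>\<^sub>F k in sequentially. measure lebesgue (sector_trunc \<alpha> (s k) - E)
      < \<epsilon> * measure lebesgue (sector_trunc \<alpha> (s k))"
    using frequently_eventually_conj[OF assms(2) small]
  proof (rule frequently_elim1)
    fix k assume k: "inverse (Suc k) < \<epsilon> \<and> sector_trunc \<alpha> (s k) \<inter> hump_set u k \<subseteq> E"
    have "measure lebesgue (sector_trunc \<alpha> (s k) - E)
        \<le> measure lebesgue (sector_trunc \<alpha> (s k) - hump_set u k)"
      using k assms hump_set_sets by (intro measure_sector_trunc_Diff_mono) auto
    also have "\<dots> < inverse (Suc k) * measure lebesgue (sector_trunc \<alpha> (s k))"
      using hump unfolding gliding_hump_def by blast
    also have "\<dots> \<le> \<epsilon> * measure lebesgue (sector_trunc \<alpha> (s k))"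
      using k by (intro mult_right_mono) auto
    finally show "measure lebesgue (sector_trunc \<alpha> (s k) - E)
      < \<epsilon> * measure lebesgue (sector_trunc \<alpha> (s k))" .
  qed
  then show "\<exists>\<^sub>F r in at_top. measure lebesgue (sector_trunc \<alpha> r - E)
      < \<epsilon> * measure lebesgue (sector_trunc \<alpha> r)"
    using hump_radius_at_top by (auto simp: frequently_def filterlim_iff)
qed

lemma summable_hump_series:
  assumes "\<And>k. norm (\<gamma> k) \<le> M"
  shows "summable (\<lambda>k. smul (\<gamma> k) (u k))"
proof (rule summable_comparison_test'[where g = "\<lambda>k. M * (1/2) ^ k" and N = 0])
  fix k
  have "M \<ge> 0" using assms[of 0] norm_ge_zero by (rule order_trans[rotated])
  then have "norm (\<gamma> k) * norm (u k) \<le> M * (1/2) ^ k"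
    using hump assms by (intro mult_mono) (auto simp: gliding_hump_def)
  then show "norm (smul (\<gamma> k) (u k)) \<le> M * (1/2) ^ k" by (simp add: norm_smul)
qed (intro summable_mult summable_geometric, simp)

text \<open>At stage \<open>k\<close> only the k-th term matters: earlier terms are small by the
  definition of \<open>hump_set\<close>, later ones by their bound on the sector of radius
  \<open>s k\<close>. Each group contributes at most M/(k+1).\<close>

lemma hump_series_approx:
  assumes M: "\<And>k. norm (\<gamma> k) \<le> M" and t: "t \<in> sector_trunc \<alpha> (s k)" "t \<in> hump_set u k"
  shows "norm (T t (\<Sum>j. smul (\<gamma> j) (u j)) - smul (\<gamma> k) (T t (u k))) \<le> 2 * M / Suc k"
proof -
  define f where "f j = smul (\<gamma> j) (T t (u j))" for j
  have M0: "M \<ge> 0" using M[of 0] norm_ge_zero by (rule order_trans[rotated])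
  have ts: "t \<in> sector \<alpha>" using t by (simp add: sector_trunc_def)
  have smul_T: "T t (smul (\<gamma> j) (u j)) = f j" for j using ts by (simp add: f_def T_smul)
  have summ: "summable f"
    using bounded_linear.summable[OF bounded_linear_T[OF ts] summable_hump_series[of \<gamma> M, OF M]]
    unfolding smul_T .
  have "T t (\<Sum>j. smul (\<gamma> j) (u j)) = (\<Sum>j. f j)"
    using bounded_linear.suminf[OF bounded_linear_T[OF ts] summable_hump_series[of \<gamma> M, OF M]]
    unfolding smul_T .
  also have "\<dots> = (\<Sum>j. f (j + Suc k)) + (\<Sum>j<k. f j) + f k"
    using suminf_split_initial_segment[OF summ, where k = "Suc k"] by simp
  finally have eq: "T t (\<Sum>j. smul (\<gamma> j) (u j)) - smul (\<gamma> k) (T t (u k))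
      = (\<Sum>j. f (j + Suc k)) + (\<Sum>j<k. f j)" by (simp add: f_def)
  have "norm (\<Sum>j<k. f j) \<le> (\<Sum>j<k. M * norm (T t (u j)))"
    unfolding f_def by (intro sum_norm_le) (simp add: norm_smul M mult_right_mono)
  also have "\<dots> = M * (\<Sum>j<k. norm (T t (u j)))" by (simp add: sum_distrib_left)
  also have "\<dots> \<le> M * inverse (Suc k)"
    using t M0 by (intro mult_left_mono) (auto simp: hump_set_def)
  finally have head: "norm (\<Sum>j<k. f j) \<le> M / Suc k" by (simp add: field_simps)
  have "norm (f (j + Suc k)) \<le> M * (1/2) ^ Suc k * (1/2) ^ j" for j
  proof -
    have "norm (T t (u (j + Suc k))) \<le> (1/2) ^ (j + Suc k)"
    proof -
      have "\<forall>i<j + Suc k. \<forall>t\<in>sector_trunc \<alpha> (s i). norm (T t (u (j + Suc k))) \<le> (1/2) ^ (j + Suc k)"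
        using hump unfolding gliding_hump_def by blast
      moreover have "k < j + Suc k" by simp
      ultimately show ?thesis using t(1) by blast
    qed
    then have "norm (f (j + Suc k)) \<le> M * (1/2) ^ (j + Suc k)"
      unfolding f_def norm_smul using M M0 by (intro mult_mono) auto
    then show ?thesis by (simp add: power_add mult_ac)
  qed
  then have "norm (\<Sum>j. f (j + Suc k)) \<le> (\<Sum>j. M * (1/2) ^ Suc k * (1/2) ^ j)"
    by (rule norm_suminf_le) (intro summable_mult summable_geometric, simp)
  also have "\<dots> = M * (1/2) ^ k"
    by (subst suminf_mult) (simp_all add: suminf_geometric summable_geometric)
  \<comment> \<open>The geometric tail is weakened to the form of the bound for the earlier
    terms.\<close>
  also have "\<dots> \<le> M * (1 / Suc k)"
  proof (intro mult_left_mono M0)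
    have "Suc k \<le> 2 ^ k" by (induction k) auto
    then have "real (Suc k) \<le> 2 ^ k" by (metis of_nat_le_iff of_nat_numeral of_nat_power)
    then show "(1/2) ^ k \<le> 1 / real (Suc k)"
      by (simp add: power_one_over field_simps del: of_nat_Suc)
  qed
  finally have tail: "norm (\<Sum>j. f (j + Suc k)) \<le> M / Suc k" by simp
  have "norm ((\<Sum>j. f (j + Suc k)) + (\<Sum>j<k. f j)) \<le> M / Suc k + M / Suc k"
    using norm_triangle_le[OF add_mono[OF tail head]] .
  also have "\<dots> = 2 * M / Suc k" by (simp only: mult_2 add_divide_distrib)
  finally show ?thesis unfolding eq .
qed

text \<open>Where \<gamma> vanishes, only the error 2M/(k+1) survives on the k-th hump. Where it has
  norm at least \<eta>, the orbit there is at least \<eta>(k+1) minus that error. Infinitely many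
  humps of both kinds give the two upper densities.\<close>

lemma hump_series_irregular:
  assumes M: "\<And>k. norm (\<gamma> k) \<le> M" and d: "d \<in> DAsym0 \<alpha> T"
    and zero: "\<exists>\<^sub>F k in sequentially. \<gamma> k = 0"
    and nonzero: "\<eta> > 0" "\<exists>\<^sub>F k in sequentially. \<eta> \<le> norm (\<gamma> k)"
  shows "distributionally_irregular \<alpha> T (d + (\<Sum>k. smul (\<gamma> k) (u k)))"
proof -
  define x where "x = (\<Sum>k. smul (\<gamma> k) (u k))"
  have lim: "(\<lambda>k. 2 * M / Suc k) \<longlonglongrightarrow> 0"
    using tendsto_mult[OF tendsto_const[of "2 * M"] LIMSEQ_inverse_real_of_nat]
    by (simp add: divide_inverse)
  have small: "upper_dens \<alpha> {t \<in> sector \<alpha>. norm (T t x) < \<epsilon>} = 1" if "\<epsilon> > 0" for \<epsilon>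
  proof (rule upper_dens_1_along_humps)
    have "\<forall>\<^sub>F k in sequentially. 2 * M / Suc k < \<epsilon>"
      using lim that by (rule order_tendstoD)
    from frequently_eventually_conj[OF zero this]
    show "\<exists>\<^sub>F k in sequentially. sector_trunc \<alpha> (s k) \<inter> hump_set u k \<subseteq> {t \<in> sector \<alpha>. norm (T t x) < \<epsilon>}"
    proof (rule frequently_elim1)
      fix k assume k: "2 * M / Suc k < \<epsilon> \<and> \<gamma> k = 0"
      then show "sector_trunc \<alpha> (s k) \<inter> hump_set u k \<subseteq> {t \<in> sector \<alpha>. norm (T t x) < \<epsilon>}"
        using hump_series_approx[of \<gamma> M _ k, OF M] by (fastforce simp: x_def hump_set_def)
    qed
  qed simp
  have large: "upper_dens \<alpha> {t \<in> sector \<alpha>. K < norm (T t x)} = 1" for K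
  proof (rule upper_dens_1_along_humps)
    have "filterlim (\<lambda>k. \<eta> * real (Suc k)) at_top sequentially"
      using nonzero(1) by (intro filterlim_tendsto_pos_mult_at_top[OF tendsto_const]
          filterlim_compose[OF filterlim_real_sequentially filterlim_Suc])
    then have "\<forall>\<^sub>F k in sequentially. K + 1 < \<eta> * real (Suc k)"
      by (simp add: filterlim_at_top_dense)
    moreover have "\<forall>\<^sub>F k in sequentially. 2 * M / Suc k < 1"
      using lim by (rule order_tendstoD) simp
    ultimately have "\<forall>\<^sub>F k in sequentially. K + 2 * M / Suc k < \<eta> * real (Suc k)"
      by eventually_elim linarith
    from frequently_eventually_conj[OF nonzero(2) this]
    show "\<exists>\<^sub>F k in sequentially. sector_trunc \<alpha> (s k) \<inter> hump_set u k \<subseteq> {t \<in> sector \<alpha>. K < norm (T t x)}"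
    proof (rule frequently_elim1)
      fix k assume k: "K + 2 * M / Suc k < \<eta> * real (Suc k) \<and> \<eta> \<le> norm (\<gamma> k)"
      show "sector_trunc \<alpha> (s k) \<inter> hump_set u k \<subseteq> {t \<in> sector \<alpha>. K < norm (T t x)}"
      proof safe
        fix t assume t: "t \<in> sector_trunc \<alpha> (s k)" "t \<in> hump_set u k"
        then show "t \<in> sector \<alpha>" by (simp add: hump_set_def)
        have "\<eta> * real (Suc k) \<le> norm (\<gamma> k) * norm (T t (u k))"
          using k t nonzero(1) by (intro mult_mono) (auto simp: hump_set_def)
        also have "\<dots> = norm (smul (\<gamma> k) (T t (u k)))" by (simp add: norm_smul)
        also have "\<dots> \<le> norm (T t x) + 2 * M / Suc k"
          using hump_series_approx[of \<gamma> M, OF M t] norm_triangle_ineq3[of "T t x" "smul (\<gamma> k) (T t (u k))"]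
          unfolding x_def by linarith
        finally show "K < norm (T t x)" using k by linarith
      qed
    qed
  qed simp
  \<comment> \<open>The orbit of \<open>d\<close> is small with density one, so intersecting with
    that set preserves upper density one and costs only a bounded amount in the thresholds.\<close>
  have "distributionally_irregular \<alpha> T (d + x)"
  proof (rule distributionally_irregularI)
    fix \<epsilon> :: real assume "\<epsilon> > 0"
    then have "upper_dens \<alpha> ({t \<in> sector \<alpha>. norm (T t x) < \<epsilon> / 2} \<inter> {t \<in> sector \<alpha>. norm (T t d) < \<epsilon> / 2}) = 1"
      using d by (intro upper_dens_1_Int small DAsym0_has_dens sets_lebesgue_orbit_norm) auto
    then show "upper_dens \<alpha> {t \<in> sector \<alpha>. norm (T t (d + x)) < \<epsilon>} = 1"
    proof (rule upper_dens_1_mono)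
      show "{t \<in> sector \<alpha>. norm (T t x) < \<epsilon> / 2} \<inter> {t \<in> sector \<alpha>. norm (T t d) < \<epsilon> / 2} \<inter> sector \<alpha>
          \<subseteq> {t \<in> sector \<alpha>. norm (T t (d + x)) < \<epsilon>}"
        using norm_T_add_le[of _ d x] by force
    qed (intro sets.Int sets_lebesgue_orbit_norm)+
  next
    fix K :: real
    have "upper_dens \<alpha> ({t \<in> sector \<alpha>. K + 1 < norm (T t x)} \<inter> {t \<in> sector \<alpha>. norm (T t d) < 1}) = 1"
      using d by (intro upper_dens_1_Int large DAsym0_has_dens sets_lebesgue_orbit_norm) auto
    then show "upper_dens \<alpha> {t \<in> sector \<alpha>. K < norm (T t (d + x))} = 1"
    proof (rule upper_dens_1_mono)
      show "{t \<in> sector \<alpha>. K + 1 < norm (T t x)} \<inter> {t \<in> sector \<alpha>. norm (T t d) < 1} \<inter> sector \<alpha>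
          \<subseteq> {t \<in> sector \<alpha>. K < norm (T t (d + x))}"
        using norm_T_add_ge[of _ x d] by force
    qed (intro sets.Int sets_lebesgue_orbit_norm)+
  qed
  then show ?thesis unfolding x_def .
qed

text \<open>The humps are split into infinitely many infinite blocks, one for each generator of the
  manifold.\<close>

definition block :: "nat \<Rightarrow> nat" where
  "block k = fst (prod_decode k)"

lemma frequently_block: "\<exists>\<^sub>F k in sequentially. block k = i"
  unfolding frequently_sequentially
proof
  fix n
  show "\<exists>k\<ge>n. block k = i"
    by (rule exI[of _ "prod_encode (i, n)"]) (simp add: block_def le_prod_encode_2)
qed

text \<open>The 0/1 coefficients make this a hump series with bounded scalar coefficients.\<close>

definition block_vector :: "nat \<Rightarrow> 'a" where
  "block_vector i = (\<Sum>k. smul (of_bool (block k = i)) (u k))"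

text \<open>Interchanging the finite and infinite sums gives one hump series whose coefficient is
  the constant \<open>b i\<close> on each block \<open>i\<close> in \<open>I\<close> and zero on all
  other blocks.\<close>

lemma block_combination_irregular:
  assumes "finite I" and d: "\<And>i. i \<in> I \<Longrightarrow> d i \<in> DAsym0 \<alpha> T"
    and "i0 \<in> I" "c i0 \<noteq> 0" and \<eta>: "\<And>i. \<eta> i > 0"
  shows "distributionally_irregular \<alpha> T (\<Sum>i\<in>I. smul (c i) (d i + \<eta> i *\<^sub>R block_vector i))"
proof -
  define b where "b i = c i * of_real (\<eta> i)" for i
  define \<gamma> where "\<gamma> k = (\<Sum>i\<in>I. b i * of_bool (block k = i))" for k
  have \<gamma>: "\<gamma> k = (if block k \<in> I then b (block k) else 0)" for k
    using sum.delta'[OF \<open>finite I\<close>, of "block k" b]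
    by (simp add: \<gamma>_def of_bool_def if_distrib[of "(*) _"] cong: if_cong)
  have M: "norm (\<gamma> k) \<le> (\<Sum>i\<in>I. norm (b i))" for k
    using \<open>finite I\<close> by (auto simp: \<gamma> intro: member_le_sum sum_nonneg)
  have summ: "summable (\<lambda>k. smul (of_bool (block k = i)) (u k))" for i
    by (rule summable_hump_series[of _ 1]) simp
  \<comment> \<open>Needed to move the scalars, possibly complex, into the infinite series.\<close>
  have bl: "bounded_linear (smul a)" for a
    by (rule bounded_linear_intro[where K = "norm a"])
      (simp_all add: scale_right_distrib norm_smul mult.commute scaleR_eq_smul scale_left_commute)
  have "(\<Sum>i\<in>I. smul (c i) (\<eta> i *\<^sub>R block_vector i)) = (\<Sum>i\<in>I. \<Sum>k. smul (b i * of_bool (block k = i)) (u k))"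
    unfolding block_vector_def scaleR_eq_smul scale_scale b_def[symmetric]
    by (simp add: bounded_linear.suminf[OF bl summ] scale_scale)
  also have "\<dots> = (\<Sum>k. \<Sum>i\<in>I. smul (b i * of_bool (block k = i)) (u k))"
    using bounded_linear.summable[OF bl summ]
    by (intro suminf_sum[symmetric]) (simp add: scale_scale)
  also have "\<dots> = (\<Sum>k. smul (\<gamma> k) (u k))"
    by (simp add: \<gamma>_def scale_sum_left)
  finally have eq: "(\<Sum>i\<in>I. smul (c i) (d i + \<eta> i *\<^sub>R block_vector i))
      = (\<Sum>i\<in>I. smul (c i) (d i)) + (\<Sum>k. smul (\<gamma> k) (u k))"
    by (simp add: scale_right_distrib sum.distrib)
  show ?thesis
    unfolding eq
  proof (rule hump_series_irregular[OF M])
    show "(\<Sum>i\<in>I. smul (c i) (d i)) \<in> DAsym0 \<alpha> T"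
      using d by (intro subspace_sum subspace_scale subspace_DAsym0)
    \<comment> \<open>As \<open>I\<close> is finite, some whole infinite block lies outside it, and
      there the coefficients vanish.\<close>
    obtain i where "i \<notin> I" using \<open>finite I\<close> ex_new_if_finite infinite_UNIV_nat by blast
    then show "\<exists>\<^sub>F k in sequentially. \<gamma> k = 0"
      by (intro frequently_elim1[OF frequently_block[of i]]) (simp add: \<gamma>)
    show "0 < norm (b i0)" using assms(4) \<eta>[of i0, THEN less_imp_neq] by (simp add: b_def)
    show "\<exists>\<^sub>F k in sequentially. norm (b i0) \<le> norm (\<gamma> k)"
      using \<open>i0 \<in> I\<close> by (intro frequently_elim1[OF frequently_block[of i0]]) (simp add: \<gamma>)
  qed
qed

section \<open>The dense manifold\<close>

lemma dense_irregular_manifold: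
  assumes dense: "closure (DAsym0 \<alpha> T) = UNIV"
    and separable: "separable_space (euclidean :: 'a topology)"
  obtains Y where "distributionally_irregular_manifold smul \<alpha> T Y" "closure Y = UNIV"
proof -
  obtain C :: "'a set" where C: "countable C" "closure C = UNIV"
    using separable unfolding separable_space_def by auto
  \<comment> \<open>Here \<open>block\<close> serves a second purpose: the index
    \<open>block i\<close> takes each value infinitely often, so each point of \<open>C\<close> is
    approximated with errors tending to 0.\<close>
  have "\<forall>i. \<exists>y. y \<in> DAsym0 \<alpha> T \<and> dist y (from_nat_into C (block i)) < inverse (Suc i)"
  proof
    fix i
    have "0 < inverse (real (Suc i))" by simp
    then show "\<exists>y. y \<in> DAsym0 \<alpha> T \<and> dist y (from_nat_into C (block i)) < inverse (Suc i)"
      using dense closure_approachable[of "from_nat_into C (block i)" "DAsym0 \<alpha> T"] by blast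
  qed
  from choice[OF this] obtain d where d: "\<And>i. d i \<in> DAsym0 \<alpha> T"
      "\<And>i. dist (d i) (from_nat_into C (block i)) < inverse (Suc i)"
    by blast
  \<comment> \<open>Chosen so that adding the irregular part moves \<open>d i\<close> by at most
    \<open>inverse (Suc i)\<close>.\<close>
  define \<eta> where "\<eta> i = inverse (Suc i) / (norm (block_vector i) + 1)" for i
  have norm_pos: "norm x + 1 > 0" for x :: 'a by (intro add_nonneg_pos) auto
  have \<eta>: "\<eta> i > 0" for i unfolding \<eta>_def by (intro divide_pos_pos norm_pos) auto
  define v where "v i = d i + \<eta> i *\<^sub>R block_vector i" for i
  have v: "dist (v i) (from_nat_into C (block i)) < 2 * inverse (Suc i)" for i
  proof -
    have "norm (\<eta> i *\<^sub>R block_vector i) = inverse (Suc i) * (norm (block_vector i) / (norm (block_vector i) + 1))"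
      using \<eta>[of i] by (simp add: \<eta>_def)
    also have "\<dots> \<le> inverse (Suc i) * 1"
      using norm_pos[of "block_vector i"] by (intro mult_left_mono) (auto simp: field_simps)
    finally have "dist (v i) (d i) \<le> inverse (Suc i)" by (simp add: v_def dist_norm)
    then show ?thesis
      using d(2)[of i] dist_triangle[of "v i" "from_nat_into C (block i)" "d i"] by linarith
  qed
  show ?thesis
  proof
    show "distributionally_irregular_manifold smul \<alpha> T (span (range v))"
      unfolding distributionally_irregular_manifold_def
    proof (intro conjI ballI)
      fix y assume y: "y \<in> span (range v) - {0}"
      then obtain F r where F: "finite F" "F \<subseteq> range v" "y = (\<Sum>a\<in>F. smul (r a) a)"
        by (auto simp: span_explicit)
      \<comment> \<open>The values of \<open>v\<close> might repeat, so one index is chosen for each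
        vector in \<open>F\<close>; on the chosen indices the sum can be reindexed.\<close>
      define \<iota> where "\<iota> = inv_into UNIV v"
      have \<iota>: "v (\<iota> a) = a" if "a \<in> F" for a
        using F that unfolding \<iota>_def by (intro f_inv_into_f) auto
      have "inj_on \<iota> F" using \<iota> by (metis inj_onI)
      have "y = (\<Sum>i\<in>\<iota> ` F. smul (r (v i)) (v i))"
        using \<open>inj_on \<iota> F\<close> \<iota> F(3) by (simp add: sum.reindex)
      moreover have "(\<Sum>a\<in>F. smul (r a) a) \<noteq> 0" using y F(3) by simp
      then obtain a where "a \<in> F" "r a \<noteq> 0"
        by (rule sum.not_neutral_contains_not_neutral) auto
      ultimately show "distributionally_irregular \<alpha> T y"
        using block_combination_irregular[of "\<iota> ` F" d "\<iota> a" "\<lambda>i. r (v i)" \<eta>] F(1) d(1) \<eta> \<iota>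
        by (simp add: v_def)
    qed simp
    show "closure (span (range v)) = UNIV"
    proof -
      have "C \<subseteq> closure (range v)"
      proof
        fix x assume "x \<in> C"
        then obtain n where n: "from_nat_into C n = x"
          using C from_nat_into_surj by metis
        show "x \<in> closure (range v)"
          unfolding closure_approachable
        proof (intro allI impI)
          fix e :: real assume "e > 0"
          then have "\<forall>\<^sub>F i in sequentially. inverse (Suc i) < e / 2"
            using LIMSEQ_inverse_real_of_nat by (intro order_tendstoD(2)[of _ 0]) auto
          from frequently_eventually_conj[OF frequently_block[of n] this]
          obtain i where i: "block i = n" "inverse (Suc i) < e / 2"
            by (auto dest: frequently_ex)
          then have "dist (v i) x < e" using v[of i] n by simp
          then show "\<exists>y\<in>range v. dist y x < e" by blast
        qed
      qed
      also have "\<dots> \<subseteq> closure (span (range v))" by (intro closure_mono span_superset)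
      finally show ?thesis using C(2) closure_mono[of C "closure (span (range v))"] by auto
    qed
  qed
qed

end

end

theorem theorem3p16:
  fixes smul :: "'k::{real_normed_field,euclidean_space} \<Rightarrow> 'a::banach \<Rightarrow> 'a"
    and \<alpha> :: real
    and T :: "complex \<Rightarrow> 'a \<Rightarrow> 'a"
  assumes space: "normed_space_over smul"
    and nonzero: "\<exists>x::'a. x \<noteq> 0"
    and separable: "separable_space (euclidean :: 'a topology)"
    and \<alpha>: "0 < \<alpha>" "\<alpha> < pi / 2"
    and semigroup: "C0_semigroup smul \<alpha> T"
    and dense: "closure (DAsym0 \<alpha> T) = UNIV"
  shows "distributionally_sensitive \<alpha> T \<longleftrightarrow>
    (\<exists>Y. distributionally_irregular_manifold smul \<alpha> T Y \<and> closure Y = UNIV)"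
proof -
  interpret normed_space_over smul by (rule space)
  interpret sector_semigroup smul \<alpha> T
    by unfold_locales (use \<alpha> semigroup in auto)
  show ?thesis
  proof
    assume "distributionally_sensitive \<alpha> T"
    then obtain u s where "gliding_hump u s" using gliding_hump_exists dense by blast
    then show "\<exists>Y. distributionally_irregular_manifold smul \<alpha> T Y \<and> closure Y = UNIV"
      using dense_irregular_manifold dense separable by metis
  next
    assume "\<exists>Y. distributionally_irregular_manifold smul \<alpha> T Y \<and> closure Y = UNIV"
    then obtain Y where Y: "distributionally_irregular_manifold smul \<alpha> T Y" "closure Y = UNIV"
      by blast
    \<comment> \<open>In a nonzero space the closed set \<open>{0}\<close> is not dense, so
      \<open>Y\<close> contains a nonzero and hence irregular vector.\<close>
    have "\<not> Y \<subseteq> {0}"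
      using Y(2) nonzero closure_mono[of Y "{0}"] by auto
    then obtain z where "z \<in> Y - {0}" by blast
    then show "distributionally_sensitive \<alpha> T"
      using Y(1) sensitive_if_irregular unfolding distributionally_irregular_manifold_def by blast
  qed
qed

end
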